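(* Consider the Constrained regime of the RCPB policy with arrival parameter $0<\lambda<1$, memory parameter $c(n)=c$ for a fixed integer $c\ge1$, and idle-server message rate $\mu(n)=\alpha/(1-\lambda)$ for a fixed constant $\alpha>0$. Then the asymptotic delay is upper bounded, uniformly over all $\lambda\in(0,1)$, as $$\mathbb{E}[W]\le\left(\sum_{k=1}^{c}\alpha^k\right)^{-1}.$$
   Context: Model: for each $n\ge1$ there are $n$ parallel unit-rate servers, each with its own infinite-capacity FIFO queue (a job in service counts as being in queue); a server is idle iff its queue is empty. Jobs arrive as a Poisson process of rate $\lambda n$, with i.i.d. exponential mean-$1$ sizes independent of arrivals, and are dispatched immediately to a queue. Resource Constrained Pull-Based (RCPB) policy with parameters $c(n)\in\{1,\dots,n\}$ and $\mu(n)>0$: (a) the dispatcher stores up to $c(n)$ server IDs (tokens) in a virtual queue; (b) each idle server sends messages to the dispatcher as a Poisson process of rate $\mu(n)$; upon receipt the server's ID is added to the virtual queue unless it is already stored or the virtual queue is full, in which case the message is discarded; (c) an arriving job is sent, if there is at least one token, to the queue of a server whose ID is chosen uniformly at random among the stored tokens, and that token is deleted; if there are no tokens, it is sent to a uniformly random queue. (When $c(n)=c$ is constant, only $n\ge c$ is considered.) Let $Q^n_i(t)$ be the number of jobs in queue $i$, $M^n(t)$ the number of tokens. $(Q^n,M^n)$ is a positive recurrent continuous-time Markov chain on $\{(q,m)\in\mathbb{Z}_+^n\times\{0,\dots,c(n)\}:\ \sum_i\mathbf{1}_{\{q_i=0\}}\ge m\}$ with transition rates: $(q,0)\to(q+e_i,0)$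 at rate $\lambda$; for $m>0$, $(q,m)\to(q+e_i,m-1)$ at rate $n\lambda\mathbf{1}_{\{q_i=0\}}/\sum_j\mathbf{1}_{\{q_j=0\}}$; $(q,m)\to(q-e_i,m)$ at rate $\mathbf{1}_{\{q_i>0\}}$; $(q,m)\to(q,m+1)$ at rate $\mu(n)(\sum_i\mathbf{1}_{\{q_i=0\}}-m)\mathbf{1}_{\{m<c(n)\}}$. $S^n_i$ is the fraction of queues with at least $i$ jobs. The queueing delay $\mathbb{E}[W^n]$ is the steady-state mean time that a job spends in queue until its service starts; by Little's law $\mathbb{E}[W^n]=\frac1\lambda\mathbb{E}\left[\sum_{i=1}^\infty S^n_i\right]-1$ (expectation under the stationary distribution). The asymptotic delay is $\mathbb{E}[W]=\limsup_{n\to\infty}\mathbb{E}[W^n]$. *)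

theory Defs
  imports "HOL-Probability.Probability"
begin

text \<open>
  A state \<open>(q, m)\<close> consists of the list \<open>q\<close> of queue lengths (\<open>q ! i\<close> is the number of jobs in
  queue \<open>i\<close>, servers being numbered from \<open>0\<close>) and the number \<open>m\<close> of tokens.
\<close>

type_synonym rcpb_state = "nat list \<times> nat"

definition idle_count :: "nat list \<Rightarrow> nat" where
  "idle_count q = card {i. i < length q \<and> q ! i = 0}"

definition rcpb_states :: "nat \<Rightarrow> nat \<Rightarrow> rcpb_state set" where
  "rcpb_states n c = {(q, m). length q = n \<and> m \<le> c \<and> m \<le> idle_count q}"

definition arrival_rate :: "nat \<Rightarrow> real \<Rightarrow> rcpb_state \<Rightarrow> nat \<Rightarrow> real" where
  "arrival_rate n lam = (\<lambda>(q, m) i.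
     if m = 0 then lam
     else real n * lam * of_bool (q ! i = 0) / real (idle_count q))"

definition message_rate :: "nat \<Rightarrow> real \<Rightarrow> rcpb_state \<Rightarrow> real" where
  "message_rate c mu = (\<lambda>(q, m). mu * (real (idle_count q) - real m) * of_bool (m < c))"

text \<open>
  Rate of jumping from \<open>(q, m)\<close> to \<open>y\<close>.  The natural-number subtraction \<open>m - 1\<close> makes an arrival
  leave \<open>m = 0\<close> unchanged and otherwise delete one token.
\<close>

definition rcpb_rate :: "nat \<Rightarrow> nat \<Rightarrow> real \<Rightarrow> real \<Rightarrow> rcpb_state \<Rightarrow> rcpb_state \<Rightarrow> real" where
  "rcpb_rate n c lam mu = (\<lambda>(q, m) y.
     (\<Sum>i<n. arrival_rate n lam (q, m) i * of_bool (y = (q[i := q ! i + 1], m - 1)))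
   + (\<Sum>i<n. of_bool (q ! i > 0) * of_bool (y = (q[i := q ! i - 1], m)))
   + message_rate c mu (q, m) * of_bool (y = (q, m + 1)))"

text \<open>
  Stationarity of \<open>p\<close> is expressed by the global balance equations.  For fixed \<open>n\<close> the total jump
  rates are bounded, so these are equivalent to invariance of \<open>p\<close> under the transition semigroup.
  Only finitely many terms of each sum are nonzero.
\<close>

definition rcpb_stationary ::
    "nat \<Rightarrow> nat \<Rightarrow> real \<Rightarrow> real \<Rightarrow> rcpb_state pmf \<Rightarrow> bool" where
  "rcpb_stationary n c lam mu p \<longleftrightarrow>
     set_pmf p \<subseteq> rcpb_states n c \<and>
     (\<forall>x\<in>rcpb_states n c.
        (\<Sum>\<^sub>\<infinity>y\<in>rcpb_states n c. pmf p y * rcpb_rate n c lam mu y x)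
      = pmf p x * (\<Sum>\<^sub>\<infinity>y\<in>rcpb_states n c. rcpb_rate n c lam mu x y))"

text \<open>The fraction of queues with at least \<open>i\<close> jobs.\<close>

definition queue_fraction :: "nat list \<Rightarrow> nat \<Rightarrow> real" where
  "queue_fraction q i = real (card {j. j < length q \<and> i \<le> q ! j}) / real (length q)"

text \<open>
  The steady-state mean waiting time of a job, given by Little's law: the mean number of jobs per
  queue divided by the arrival rate per queue is the mean sojourn time, from which the mean
  service time \<open>1\<close> is subtracted.  It is extended real-valued, so that no integrability is presupposed.
\<close>

definition queueing_delay :: "real \<Rightarrow> rcpb_state pmf \<Rightarrow> ereal" where
  "queueing_delay lam p =
     ereal (1 / lam) *
       enn2ereal (\<integral>\<^sup>+ x. (\<Sum>i. ennreal (queue_fraction (fst x) (Suc i))) \<partial>measure_pmf p) - 1"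

definition asymptotic_delay :: "real \<Rightarrow> (nat \<Rightarrow> rcpb_state pmf) \<Rightarrow> ereal" where
  "asymptotic_delay lam p = limsup (\<lambda>n. queueing_delay lam (p n))"

end

theory Submission
  imports Defs
begin

text \<open>
  Write \<open>S k\<close> for the fraction of queues with at least \<open>k\<close> jobs and \<open>z\<close> for the indicator of the
  event that no token is stored. A stationary law \<open>p\<close> gives mean \<open>0\<close> to the generator applied to any
  bounded function (\<open>generator_expectation_zero\<close>); the proof consists in choosing test functions.

  Functions of a single level show that the mean of \<open>S 1\<close> is \<open>lam\<close> and that the mean of
  \<open>S (k + 2)\<close> is \<open>lam\<close> times the mean of \<open>z * S (k + 1)\<close> (\<open>mean_level\<close>). The delay is therefore
  governed by the correlation of \<open>z\<close> with the levels.

  The number of tokens moves at speed \<open>n\<close> while the levels move at speed \<open>1\<close>. Test functions that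
  multiply a slowly varying function of the queues by the indicator of more than \<open>k\<close> tokens show
  that \<open>z\<close> may be replaced, up to \<open>O(1/n)\<close>, by the stationary probability of no token in a
  birth-death chain with the current fraction of idle servers (\<open>no_token_average\<close>).

  That probability is a Lipschitz function of \<open>S 1\<close>, so it remains to see that \<open>S 1\<close> concentrates at
  \<open>lam\<close> (\<open>busy_concentration\<close>). The mean-field dynamics of the levels is cooperative, and it loses mass
  only through \<open>S 1\<close>; consequently the sum of the positive parts of the deviations from its fixed point
  is a Lyapunov function whose dissipation is the positive part of \<open>S 1 - lam\<close>. A smoothed
  version of it, truncated to finitely many levels, is an admissible test function.

  With \<open>P\<close> the no-token probability at \<open>S 1 = lam\<close>, each level mean is then at most \<open>lam * P\<close> times
  the previous one, up to an error that tends to \<open>0\<close>. Summing the geometric series bounds the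
  asymptotic delay by \<open>lam * P / (1 - lam * P)\<close>, and \<open>limit_delay_le\<close> compares this with the
  claimed bound.
\<close>

section \<open>Expectations under a discrete law as infinite sums\<close>

lemma summable_on_pmf_mult:
  fixes h :: "'a \<Rightarrow> real"
  assumes "\<And>x. x \<in> A \<Longrightarrow> \<bar>h x\<bar> \<le> B"
  shows "(\<lambda>x. norm (pmf p x * h x)) summable_on A"
proof -
  have "Infinite_Set_Sum.abs_summable_on (pmf p) A"
    by (rule pmf_abs_summable)
  then have "(\<lambda>x. B * pmf p x) summable_on A"
    by (intro summable_on_cmult_right) (simp flip: abs_summable_equivalent)
  then show ?thesis
  proof (rule summable_on_comparison_test)
    fix x assume "x \<in> A"
    then show "norm (pmf p x * h x) \<le> B * pmf p x"
      using assms by (simp add: abs_mult mult.commute mult_right_mono)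
  qed simp
qed

lemma expectation_eq_infsum:
  fixes h :: "'a \<Rightarrow> real"
  assumes sub: "set_pmf p \<subseteq> A" and bound: "\<And>x. x \<in> A \<Longrightarrow> \<bar>h x\<bar> \<le> B"
  shows "measure_pmf.expectation p h = (\<Sum>\<^sub>\<infinity>x\<in>A. pmf p x * h x)"
proof -
  have zero: "pmf p x = 0" if "x \<notin> A" for x
    using sub that by (auto simp: set_pmf_iff)
  have "measure_pmf.expectation p h = (\<integral>x. pmf p x * h x \<partial>count_space UNIV)"
    unfolding measure_pmf_eq_density
    by (subst integral_density) (auto simp: pmf_nonneg)
  also have "\<dots> = infsetsum (\<lambda>x. pmf p x * h x) A"
    unfolding infsetsum_altdef set_lebesgue_integral_def
    by (intro Bochner_Integration.integral_cong) (auto simp: indicator_def zero)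
  also have "\<dots> = (\<Sum>\<^sub>\<infinity>x\<in>A. pmf p x * h x)"
    by (intro infsetsum_infsum)
      (use summable_on_pmf_mult[of A h B p, OF bound] in \<open>simp flip: abs_summable_equivalent\<close>)
  finally show ?thesis .
qed

section \<open>The stationary law annihilates the generator\<close>

definition jump_sum :: "nat \<Rightarrow> nat \<Rightarrow> real \<Rightarrow> real \<Rightarrow> (rcpb_state \<Rightarrow> real) \<Rightarrow> rcpb_state \<Rightarrow> real" where
  "jump_sum n c lam mu f = (\<lambda>(q, m).
     (\<Sum>i<n. arrival_rate n lam (q, m) i * f (q[i := q ! i + 1], m - 1))
   + (\<Sum>i<n. of_bool (q ! i > 0) * f (q[i := q ! i - 1], m))
   + message_rate c mu (q, m) * f (q, m + 1))"

definition generator :: "nat \<Rightarrow> nat \<Rightarrow> real \<Rightarrow> real \<Rightarrow> (rcpb_state \<Rightarrow> real) \<Rightarrow> rcpb_state \<Rightarrow> real" where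
  "generator n c lam mu f = (\<lambda>(q, m).
     (\<Sum>i<n. arrival_rate n lam (q, m) i * (f (q[i := q ! i + 1], m - 1) - f (q, m)))
   + (\<Sum>i<n. of_bool (q ! i > 0) * (f (q[i := q ! i - 1], m) - f (q, m)))
   + message_rate c mu (q, m) * (f (q, m + 1) - f (q, m)))"

lemma generator_eq:
  "generator n c lam mu f x = jump_sum n c lam mu f x - f x * jump_sum n c lam mu (\<lambda>_. 1) x"
  by (cases x) (simp add: generator_def jump_sum_def sum_subtractf sum_distrib_left algebra_simps)

lemma sum_of_bool_card: "(\<Sum>i<n::nat. of_bool (P i) :: real) = real (card {i. i < n \<and> P i})"
proof -
  have "{..<n} \<inter> {i. P i} = {i. i < n \<and> P i}" by auto
  then show ?thesis by simp
qed

lemma idle_count_eq: "length q = n \<Longrightarrow> real (idle_count q) = (\<Sum>i<n. of_bool (q ! i = 0))"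
  by (simp add: idle_count_def sum_of_bool_card)

lemma sum_list_update:
  fixes g :: "'a \<Rightarrow> real"
  assumes "i < n" "length q = n"
  shows "(\<Sum>j<n. g (q[i := v] ! j)) = (\<Sum>j<n. g (q ! j)) - g (q ! i) + g v"
proof -
  have "(\<Sum>j<n. g (q[i := v] ! j)) = g v + (\<Sum>j\<in>{..<n}-{i}. g (q[i := v] ! j))"
    using assms by (subst sum.remove[of _ i]) auto
  also have "(\<Sum>j\<in>{..<n}-{i}. g (q[i := v] ! j)) = (\<Sum>j\<in>{..<n}-{i}. g (q ! j))"
    by (intro sum.cong) auto
  also have "\<dots> = (\<Sum>j<n. g (q ! j)) - g (q ! i)"
    using assms by (subst (2) sum.remove[of _ i]) auto
  finally show ?thesis by simp
qed

lemma idle_count_update: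
  assumes "i < n" "length q = n"
  shows "real (idle_count (q[i := v])) = real (idle_count q) - of_bool (q ! i = 0) + of_bool (v = 0)"
  using assms sum_list_update[of i n q "\<lambda>x. of_bool (x = 0)" v] by (simp add: idle_count_eq[of _ n])

locale rcpb_chain =
  fixes n c :: nat and lam mu :: real and p :: "rcpb_state pmf"
  assumes n_pos: "0 < n" and lam_pos: "0 < lam" and lam_less: "lam < 1" and mu_pos: "0 < mu"
    and stationary: "rcpb_stationary n c lam mu p"
begin

abbreviation "states \<equiv> rcpb_states n c"
abbreviation "E \<equiv> measure_pmf.expectation p"
abbreviation "gen \<equiv> generator n c lam mu"

lemma statesD:
  assumes "(q, m) \<in> states"
  shows "length q = n" "m \<le> c" "m \<le> idle_count q"
  using assms by (auto simp: rcpb_states_def)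

lemma set_pmf_states: "set_pmf p \<subseteq> states"
  using stationary by (simp add: rcpb_stationary_def)

lemma idle_le: "(q, m) \<in> states \<Longrightarrow> real (idle_count q) \<le> real n"
proof -
  assume "(q, m) \<in> states"
  then have "length q = n" by (rule statesD)
  moreover have "card {i. i < n \<and> q ! i = 0} \<le> card {..<n}"
    by (rule card_mono) auto
  ultimately show ?thesis by (simp add: idle_count_def)
qed

lemma arrival_nonneg: "0 \<le> arrival_rate n lam x i"
  using lam_pos by (cases x) (simp add: arrival_rate_def)

lemma message_nonneg: "x \<in> states \<Longrightarrow> 0 \<le> message_rate c mu x"
  using mu_pos by (cases x) (auto simp: message_rate_def dest: statesD)

lemma message_le: "x \<in> states \<Longrightarrow> message_rate c mu x \<le> mu * real n"
  using mu_pos idle_le by (cases x) (fastforce simp: message_rate_def intro!: mult_left_mono)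

lemma sum_arrival:
  assumes "(q, m) \<in> states"
  shows "(\<Sum>i<n. arrival_rate n lam (q, m) i) = real n * lam"
proof (cases "m = 0")
  case False
  have "(\<Sum>i<n. arrival_rate n lam (q, m) i)
      = real n * lam * (\<Sum>i<n. of_bool (q ! i = 0)) / real (idle_count q)"
    using False unfolding sum_distrib_left sum_divide_distrib
    by (intro sum.cong) (auto simp: arrival_rate_def)
  also have "(\<Sum>i<n. of_bool (q ! i = 0)) = real (idle_count q)"
    using assms by (simp add: idle_count_eq[OF statesD(1)])
  finally show ?thesis using False statesD[OF assms] by simp
qed (simp add: arrival_rate_def)

text \<open>
  The next three lemmas say that no positive rate leads out of the state space. Hence each row
  sum, taken over the state space only, sees all jump targets.
\<close>

lemma arrival_target:
  assumes x: "(q, m) \<in> states" and i: "i < n" and nz: "arrival_rate n lam (q, m) i \<noteq> 0"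
  shows "(q[i := q ! i + 1], m - 1) \<in> states"
proof -
  note s = statesD[OF x]
  have "m = 0 \<or> q ! i = 0" using nz by (auto simp: arrival_rate_def split: if_splits)
  then have "m - 1 \<le> idle_count (q[i := q ! i + 1])"
    using s idle_count_update[OF i s(1), of "q ! i + 1"] by auto
  then show ?thesis using s by (auto simp: rcpb_states_def)
qed

lemma departure_target:
  assumes x: "(q, m) \<in> states" and i: "i < n" and nz: "q ! i > 0"
  shows "(q[i := q ! i - 1], m) \<in> states"
proof -
  note s = statesD[OF x]
  have "real (idle_count q) \<le> real (idle_count (q[i := q ! i - 1]))"
    using nz idle_count_update[OF i s(1), of "q ! i - 1"] by auto
  then show ?thesis using s by (auto simp: rcpb_states_def)
qed

lemma message_target:
  assumes x: "(q, m) \<in> states" and nz: "message_rate c mu (q, m) \<noteq> 0"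
  shows "(q, m + 1) \<in> states"
proof -
  have "m < c" "idle_count q \<noteq> m" using nz by (auto simp: message_rate_def)
  then show ?thesis using statesD[OF x] by (auto simp: rcpb_states_def)
qed

lemma has_sum_point:
  fixes a :: real
  assumes "a \<noteq> 0 \<Longrightarrow> t \<in> A"
  shows "((\<lambda>x. a * of_bool (x = t) * g x) has_sum (a * g t)) A"
proof (cases "a = 0")
  case False
  then show ?thesis using assms
    by (intro has_sum_finite_neutralI[where B="{t}"]) auto
qed simp

lemma has_sum_sum:
  fixes f :: "'i \<Rightarrow> 'a \<Rightarrow> real"
  assumes "finite I" "\<And>i. i \<in> I \<Longrightarrow> (f i has_sum s i) A"
  shows "((\<lambda>x. \<Sum>i\<in>I. f i x) has_sum (\<Sum>i\<in>I. s i)) A"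
  using assms by (induction I) (auto intro!: has_sum_add)

lemma has_sum_rate:
  assumes y: "y \<in> states"
  shows "((\<lambda>x. rcpb_rate n c lam mu y x * g x) has_sum jump_sum n c lam mu g y) states"
proof -
  obtain q m where y': "y = (q, m)" by (cases y)
  have x: "(q, m) \<in> states" using y y' by simp
  have sum_pt: "((\<lambda>x. \<Sum>i<n. a i * of_bool (x = t i) * g x) has_sum (\<Sum>i<n. a i * g (t i))) states"
    if "\<And>i. i < n \<Longrightarrow> a i \<noteq> 0 \<Longrightarrow> t i \<in> states" for a :: "nat \<Rightarrow> real" and t
    using that by (intro has_sum_sum has_sum_point) auto
  have "((\<lambda>x. (\<Sum>i<n. arrival_rate n lam (q, m) i * of_bool (x = (q[i := q ! i + 1], m - 1)) * g x)
      + (\<Sum>i<n. of_bool (q ! i > 0) * of_bool (x = (q[i := q ! i - 1], m)) * g x)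
      + message_rate c mu (q, m) * of_bool (x = (q, m + 1)) * g x)
     has_sum ((\<Sum>i<n. arrival_rate n lam (q, m) i * g (q[i := q ! i + 1], m - 1))
   + (\<Sum>i<n. of_bool (q ! i > 0) * g (q[i := q ! i - 1], m))
   + message_rate c mu (q, m) * g (q, m + 1))) states"
    by (intro has_sum_add sum_pt has_sum_point)
      (use arrival_target[OF x] departure_target[OF x] message_target[OF x] in auto)
  then show ?thesis
    by (simp only: y' rcpb_rate_def jump_sum_def prod.case sum_distrib_right distrib_right)
qed

lemma rate_nonneg: "y \<in> states \<Longrightarrow> 0 \<le> rcpb_rate n c lam mu y x"
  using message_nonneg[of y] arrival_nonneg[of y]
  by (cases y) (auto simp: rcpb_rate_def intro!: add_nonneg_nonneg sum_nonneg)

lemma jump_sum_bound: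
  assumes x: "x \<in> states" and B: "0 \<le> B" and f: "\<And>y. y \<in> states \<Longrightarrow> \<bar>f y\<bar> \<le> B"
  shows "\<bar>jump_sum n c lam mu f x\<bar> \<le> (real n * lam + real n + mu * real n) * B"
proof -
  obtain q m where x': "x = (q, m)" by (cases x)
  have xs: "(q, m) \<in> states" using x x' by simp
  have "\<bar>\<Sum>i<n. arrival_rate n lam (q, m) i * f (q[i := q ! i + 1], m - 1)\<bar>
      \<le> (\<Sum>i<n. arrival_rate n lam (q, m) i * B)"
  proof (rule order_trans[OF sum_abs], rule sum_mono)
    fix i assume "i \<in> {..<n}"
    then show "\<bar>arrival_rate n lam (q, m) i * f (q[i := q ! i + 1], m - 1)\<bar>
        \<le> arrival_rate n lam (q, m) i * B"
      using arrival_nonneg[of "(q, m)" i] arrival_target[OF xs, of i] f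
      by (cases "arrival_rate n lam (q, m) i = 0") (auto simp: abs_mult mult_left_mono)
  qed
  also have "\<dots> = real n * lam * B" by (simp add: sum_arrival[OF xs] flip: sum_distrib_right)
  finally have 1: "\<bar>\<Sum>i<n. arrival_rate n lam (q, m) i * f (q[i := q ! i + 1], m - 1)\<bar> \<le> real n * lam * B" .
  have "\<bar>\<Sum>i<n. of_bool (q ! i > 0) * f (q[i := q ! i - 1], m)\<bar> \<le> (\<Sum>i<n. B)"
    using departure_target[OF xs] f B
    by (intro order_trans[OF sum_abs] sum_mono) (auto simp: of_bool_def)
  then have 2: "\<bar>\<Sum>i<n. of_bool (q ! i > 0) * f (q[i := q ! i - 1], m)\<bar> \<le> real n * B" by simp
  have "\<bar>message_rate c mu (q, m) * f (q, m + 1)\<bar> \<le> message_rate c mu (q, m) * B"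
    using message_nonneg[OF xs] message_target[OF xs] f
    by (cases "message_rate c mu (q, m) = 0") (auto simp: abs_mult mult_left_mono)
  also have "\<dots> \<le> mu * real n * B"
    using message_le[OF xs] B by (rule mult_right_mono)
  finally have 3: "\<bar>message_rate c mu (q, m) * f (q, m + 1)\<bar> \<le> mu * real n * B" .
  show ?thesis
    unfolding x' jump_sum_def prod.case using 1 2 3 unfolding ring_distribs by linarith
qed

text \<open>
  Summing the balance equations against \<open>f\<close> and exchanging the two sums is legitimate because \<open>f\<close>
  and the total jump rates are bounded. Every later estimate is this identity for a suitable \<open>f\<close>.
\<close>

lemma generator_expectation_zero:
  assumes f: "\<And>x. x \<in> states \<Longrightarrow> \<bar>f x\<bar> \<le> B"
  shows "E (gen f) = 0"
proof -
  let ?r = "rcpb_rate n c lam mu" and ?J = "jump_sum n c lam mu"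
  let ?R = "?J (\<lambda>_. 1)" and ?C = "real n * lam + real n + mu * real n"
  define D where "D = max B 0"
  have D: "0 \<le> D" "\<And>x. x \<in> states \<Longrightarrow> \<bar>f x\<bar> \<le> D"
    using f by (auto simp: D_def le_max_iff_disj)
  have JB: "\<bar>?J f x\<bar> \<le> ?C * D" "\<bar>f x * ?R x\<bar> \<le> ?C * D" "\<bar>?R x\<bar> \<le> ?C" if "x \<in> states" for x
  proof -
    show "\<bar>?J f x\<bar> \<le> ?C * D" by (rule jump_sum_bound) (use that D in auto)
    show R: "\<bar>?R x\<bar> \<le> ?C" using jump_sum_bound[of x 1 "\<lambda>_. 1"] that by simp
    show "\<bar>f x * ?R x\<bar> \<le> ?C * D"
      using mult_mono[OF R D(2)[OF that]] D(1) lam_pos mu_pos by (simp add: abs_mult mult.commute)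
  qed
  have R_inf: "(\<Sum>\<^sub>\<infinity>x\<in>states. ?r y x) = ?R y" if "y \<in> states" for y
    using has_sum_rate[OF that, of "\<lambda>_. 1"] by (simp add: infsumI)
  have "(\<lambda>z. pmf p (fst z) * ?r (fst z) (snd z)) summable_on (states \<times> states)"
  proof (rule summable_on_SigmaI)
    fix y assume y: "y \<in> states"
    show "((\<lambda>x. pmf p (fst (y, x)) * ?r (fst (y, x)) (snd (y, x))) has_sum pmf p y * ?R y) states"
      using has_sum_cmult_right[OF has_sum_rate[OF y, of "\<lambda>_. 1"], of "pmf p y"] by simp
  next
    show "(\<lambda>y. pmf p y * ?R y) summable_on states"
      using summable_on_pmf_mult[of states ?R ?C p, OF JB(3)] summable_on_iff_abs_summable_on_real
      by blast
  qed (auto intro!: mult_nonneg_nonneg rate_nonneg)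
  then have "(\<lambda>z. D * (pmf p (fst z) * ?r (fst z) (snd z))) summable_on (states \<times> states)"
    by (rule summable_on_cmult_right)
  then have "(\<lambda>z. norm (pmf p (fst z) * (?r (fst z) (snd z) * f (snd z)))) summable_on (states \<times> states)"
  proof (rule summable_on_comparison_test)
    fix z assume "z \<in> states \<times> states"
    then have "0 \<le> ?r (fst z) (snd z)" "\<bar>f (snd z)\<bar> \<le> D"
      using D by (auto intro!: mult_nonneg_nonneg rate_nonneg)
    then show "norm (pmf p (fst z) * (?r (fst z) (snd z) * f (snd z))) \<le> D * (pmf p (fst z) * ?r (fst z) (snd z))"
      using mult_left_mono[of "\<bar>f (snd z)\<bar>" D "pmf p (fst z) * ?r (fst z) (snd z)"]
      by (simp add: abs_mult mult_ac)
  qed auto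
  then have S: "(\<lambda>(y, x). pmf p y * (?r y x * f x)) summable_on (states \<times> states)"
    unfolding case_prod_unfold by (rule iffD2[OF summable_on_iff_abs_summable_on_real])
  have "E (?J f) = (\<Sum>\<^sub>\<infinity>y\<in>states. pmf p y * ?J f y)"
    by (rule expectation_eq_infsum[OF set_pmf_states JB(1)])
  also have "\<dots> = (\<Sum>\<^sub>\<infinity>y\<in>states. \<Sum>\<^sub>\<infinity>x\<in>states. pmf p y * (?r y x * f x))"
    by (rule infsum_cong) (rule infsumI[symmetric, OF has_sum_cmult_right[OF has_sum_rate]])
  also have "\<dots> = (\<Sum>\<^sub>\<infinity>x\<in>states. \<Sum>\<^sub>\<infinity>y\<in>states. pmf p y * (?r y x * f x))"
    by (rule infsum_swap_banach[OF S])
  also have "\<dots> = (\<Sum>\<^sub>\<infinity>x\<in>states. (\<Sum>\<^sub>\<infinity>y\<in>states. pmf p y * ?r y x) * f x)"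
    by (intro infsum_cong) (simp add: infsum_cmult_left' flip: mult.assoc)
  also have "\<dots> = (\<Sum>\<^sub>\<infinity>x\<in>states. pmf p x * (f x * ?R x))"
    using stationary by (intro infsum_cong) (simp add: rcpb_stationary_def R_inf mult_ac)
  also have "\<dots> = E (\<lambda>x. f x * ?R x)"
    by (rule expectation_eq_infsum[OF set_pmf_states JB(2), symmetric])
  finally have "E (?J f) = E (\<lambda>x. f x * ?R x)" .
  moreover have "integrable p (?J f)" "integrable p (\<lambda>x. f x * ?R x)"
    using JB subsetD[OF set_pmf_states]
    by (auto intro!: measure_pmf.integrable_const_bound[where B="?C * D"] AE_pmfI simp del: split_paired_All)
  ultimately show ?thesis by (simp add: generator_eq[abs_def])
qed

end

section \<open>Mean occupancy of the levels\<close>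

lemma queue_fraction_eq:
  assumes "length q = n"
  shows "queue_fraction q k = (\<Sum>j<n. of_bool (k \<le> q ! j)) / real n"
  using assms by (simp add: queue_fraction_def sum_of_bool_card)

lemma queue_fraction_nonneg: "0 \<le> queue_fraction q k"
  by (simp add: queue_fraction_def)

lemma queue_fraction_le_1: "queue_fraction q k \<le> 1"
proof -
  have "card {j. j < length q \<and> k \<le> q ! j} \<le> card {..<length q}"
    by (rule card_mono) auto
  then show ?thesis by (auto simp: queue_fraction_def divide_le_eq_1)
qed

lemma queue_fraction_0: "q \<noteq> [] \<Longrightarrow> queue_fraction q 0 = 1"
  by (simp add: queue_fraction_def)

lemma queue_fraction_diff:
  assumes "length q = n"
  shows "queue_fraction q k - queue_fraction q (Suc k) = (\<Sum>j<n. of_bool (q ! j = k)) / real n"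
proof -
  have "of_bool (k \<le> x) - of_bool (Suc k \<le> x) = (of_bool (x = k) :: real)" for x by auto
  then show ?thesis
    unfolding queue_fraction_eq[OF assms] diff_divide_distrib[symmetric] sum_subtractf[symmetric]
    by (simp only:)
qed

lemma queue_fraction_Suc_le: "queue_fraction q (Suc k) \<le> queue_fraction q k"
  using queue_fraction_diff[OF refl, of q k] sum_nonneg[of "{..<length q}" "\<lambda>j. of_bool (q ! j = k) :: real"]
  by (smt (verit) divide_nonneg_nonneg of_nat_0_le_iff of_bool_def)

lemma queue_fraction_update:
  assumes "i < n" "length q = n"
  shows "queue_fraction (q[i := v]) k
    = queue_fraction q k + (of_bool (k \<le> v) - of_bool (k \<le> q ! i)) / real n"
  using assms sum_list_update[of i n q "\<lambda>x. of_bool (k \<le> x)" v]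
  by (simp add: queue_fraction_eq[of _ n] diff_divide_distrib add_divide_distrib)

lemma queue_fraction_tendsto_0: "(\<lambda>k. queue_fraction q k) \<longlonglongrightarrow> 0"
proof (rule tendsto_eventually)
  show "\<forall>\<^sub>F k in sequentially. queue_fraction q k = 0"
    using eventually_gt_at_top[of "sum_list q"]
  proof eventually_elim
    case (elim k)
    then have "{j. j < length q \<and> k \<le> q ! j} = {}"
      using elem_le_sum_list[of _ q] by (fastforce simp: not_le)
    then show ?case by (simp add: queue_fraction_def)
  qed
qed

context rcpb_chain
begin

text \<open>
  With \<open>n\<close> fixed every quantity considered is bounded on the state space, so integrability follows
  from closure rules.
\<close>

definition state_bounded :: "(rcpb_state \<Rightarrow> real) \<Rightarrow> bool" where
  "state_bounded f \<longleftrightarrow> (\<exists>B. \<forall>x\<in>states. \<bar>f x\<bar> \<le> B)"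

lemma state_boundedI: "(\<And>x. x \<in> states \<Longrightarrow> \<bar>f x\<bar> \<le> B) \<Longrightarrow> state_bounded f"
  unfolding state_bounded_def by blast

lemma bounded_const: "state_bounded (\<lambda>_. a)"
  by (rule state_boundedI[of _ "\<bar>a\<bar>"]) simp

lemma bounded_of_bool: "state_bounded (\<lambda>x. of_bool (P x))"
  by (rule state_boundedI[of _ 1]) simp

lemma bounded_add:
  assumes "state_bounded f" "state_bounded g"
  shows "state_bounded (\<lambda>x. f x + g x)"
proof -
  obtain A B where AB: "\<And>x. x \<in> states \<Longrightarrow> \<bar>f x\<bar> \<le> A" "\<And>x. x \<in> states \<Longrightarrow> \<bar>g x\<bar> \<le> B"
    using assms by (auto simp: state_bounded_def)
  show ?thesis by (rule state_boundedI[of _ "A + B"]) (use AB in fastforce)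
qed

lemma bounded_mult:
  assumes "state_bounded f" "state_bounded g"
  shows "state_bounded (\<lambda>x. f x * g x)"
proof -
  obtain A B where AB: "\<And>x. x \<in> states \<Longrightarrow> \<bar>f x\<bar> \<le> A" "\<And>x. x \<in> states \<Longrightarrow> \<bar>g x\<bar> \<le> B"
    using assms by (auto simp: state_bounded_def)
  show ?thesis
    by (rule state_boundedI[of _ "A * B"])
      (use AB in \<open>auto simp: abs_mult intro!: mult_mono order_trans[OF abs_ge_zero]\<close>)
qed

lemma bounded_diff:
  assumes "state_bounded f" "state_bounded g"
  shows "state_bounded (\<lambda>x. f x - g x)"
  using bounded_add[OF assms(1) bounded_mult[OF bounded_const[of "-1"] assms(2)]] by simp

lemma bounded_power: "state_bounded f \<Longrightarrow> state_bounded (\<lambda>x. f x ^ k)"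
  by (induction k) (auto intro: bounded_const bounded_mult)

lemma bounded_sum: "(\<And>i. i \<in> I \<Longrightarrow> state_bounded (f i)) \<Longrightarrow> state_bounded (\<lambda>x. \<Sum>i\<in>I. f i x)"
  by (induction I rule: infinite_finite_induct) (auto intro: bounded_const bounded_add)

text \<open>
  The queue fractions take at most \<open>n + 1\<close> values, which bounds \<open>g\<close> of them for arbitrary \<open>g\<close>.
\<close>

lemma bounded_level: "state_bounded (\<lambda>x. g (queue_fraction (fst x) k))"
proof (rule state_boundedI)
  fix x assume "x \<in> states"
  then have len: "length (fst x) = n" by (cases x) (auto dest: statesD)
  have "card {j. j < n \<and> k \<le> fst x ! j} \<le> card {..<n}" by (rule card_mono) auto
  then have "\<bar>g (queue_fraction (fst x) k)\<bar> \<in> (\<lambda>j. \<bar>g (real j / real n)\<bar>) ` {..n}"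
    by (auto simp: queue_fraction_def len)
  then show "\<bar>g (queue_fraction (fst x) k)\<bar> \<le> Max ((\<lambda>j. \<bar>g (real j / real n)\<bar>) ` {..n})"
    by (intro Max_ge) auto
qed

lemmas bounded_intros = bounded_const bounded_of_bool bounded_add bounded_mult bounded_diff
  bounded_power bounded_sum bounded_level bounded_level[of "\<lambda>x. x"]

lemma integrable_bounded: "state_bounded f \<Longrightarrow> integrable p f"
  unfolding state_bounded_def using set_pmf_states
  by (force intro: measure_pmf.integrable_const_bound simp: AE_measure_pmf_iff)

lemma E_cong: "(\<And>x. x \<in> states \<Longrightarrow> f x = g x) \<Longrightarrow> E f = E g"
  using set_pmf_states by (intro integral_cong_AE) (auto simp: AE_measure_pmf_iff)

lemma E_mono:
  assumes "\<And>x. x \<in> states \<Longrightarrow> f x \<le> g x" "state_bounded f" "state_bounded g"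
  shows "E f \<le> E g"
  using set_pmf_states assms
  by (intro integral_mono_AE integrable_bounded) (auto simp: AE_measure_pmf_iff)

lemma E_diff: "state_bounded f \<Longrightarrow> state_bounded g \<Longrightarrow> E (\<lambda>x. f x - g x) = E f - E g"
  by (simp add: integrable_bounded)

lemma E_sum: "(\<And>i. i \<in> I \<Longrightarrow> state_bounded (f i)) \<Longrightarrow> E (\<lambda>x. \<Sum>i\<in>I. f i x) = (\<Sum>i\<in>I. E (f i))"
  by (simp add: integrable_bounded)

lemma E_gen: "state_bounded f \<Longrightarrow> E (gen f) = 0"
  unfolding state_bounded_def using generator_expectation_zero by blast

abbreviation no_token :: "rcpb_state \<Rightarrow> real" where
  "no_token x \<equiv> of_bool (snd x = 0)"

abbreviation S :: "nat \<Rightarrow> rcpb_state \<Rightarrow> real" where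
  "S k x \<equiv> queue_fraction (fst x) k"

text \<open>
  The level \<open>S (k + 1)\<close> rises when an arrival meets a queue of length exactly \<open>k\<close>: without tokens
  a random queue is hit, with tokens always an empty one.
\<close>

definition up_rate :: "nat \<Rightarrow> rcpb_state \<Rightarrow> real" where
  "up_rate k x = lam * (no_token x * (S k x - S (Suc k) x) + (1 - no_token x) * of_bool (k = 0))"

lemma gen_level:
  assumes x: "x \<in> states"
  shows "gen (\<lambda>x. g (S (Suc k) x)) x
    = real n * up_rate k x * (g (S (Suc k) x + 1 / real n) - g (S (Suc k) x))
    + real n * (S (Suc k) x - S (Suc (Suc k)) x) * (g (S (Suc k) x - 1 / real n) - g (S (Suc k) x))"
proof -
  obtain q m where x': "x = (q, m)" by (cases x)
  have xs: "(q, m) \<in> states" using x x' by simp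
  have len: "length q = n" using statesD(1)[OF xs] .
  define s where "s = queue_fraction q (Suc k)"
  define dp where "dp = g (s + 1 / real n) - g s"
  define dm where "dm = g (s - 1 / real n) - g s"
  have up: "g (queue_fraction (q[i := q ! i + 1]) (Suc k)) - g s = of_bool (q ! i = k) * dp" if "i < n" for i
    using that queue_fraction_update[OF that len, of "q ! i + 1" "Suc k"]
    by (auto simp: s_def dp_def)
  have down: "of_bool (q ! i > 0) * (g (queue_fraction (q[i := q ! i - 1]) (Suc k)) - g s) = of_bool (q ! i = Suc k) * dm" if "i < n" for i
    using that queue_fraction_update[OF that len, of "q ! i - 1" "Suc k"]
    by (auto simp: s_def dm_def)
  have num: "(\<Sum>i<n. of_bool (q ! i = j)) = real n * (queue_fraction q j - queue_fraction q (Suc j))" for j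
    using n_pos by (simp add: queue_fraction_diff[OF len])
  have "(\<Sum>i<n. arrival_rate n lam (q, m) i * (g (queue_fraction (q[i := q ! i + 1]) (Suc k)) - g s))
      = real n * up_rate k (q, m) * dp"
  proof (cases "m = 0")
    case True
    then have "(\<Sum>i<n. arrival_rate n lam (q, m) i * (g (queue_fraction (q[i := q ! i + 1]) (Suc k)) - g s))
      = lam * (\<Sum>i<n. of_bool (q ! i = k)) * dp"
      unfolding sum_distrib_left sum_distrib_right by (intro sum.cong) (auto simp: up[unfolded Suc_eq_plus1[symmetric]] arrival_rate_def)
    then show ?thesis by (simp add: num up_rate_def True)
  next
    case False
    then have "(\<Sum>i<n. arrival_rate n lam (q, m) i * (g (queue_fraction (q[i := q ! i + 1]) (Suc k)) - g s))
      = (\<Sum>i<n. arrival_rate n lam (q, m) i) * (of_bool (k = 0) * dp)"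
      unfolding sum_distrib_right by (intro sum.cong) (auto simp: up[unfolded Suc_eq_plus1[symmetric]] arrival_rate_def)
    then show ?thesis using False by (simp add: sum_arrival[OF xs] up_rate_def)
  qed
  moreover have "(\<Sum>i<n. of_bool (q ! i > 0) * (g (queue_fraction (q[i := q ! i - 1]) (Suc k)) - g s))
      = (\<Sum>i<n. of_bool (q ! i = Suc k)) * dm"
    unfolding sum_distrib_right by (intro sum.cong) (auto simp only: down lessThan_iff)
  ultimately show ?thesis
    by (simp add: x' generator_def num dp_def dm_def s_def)
qed

lemma level_balance:
  "E (\<lambda>x. up_rate k x * (g (S (Suc k) x + 1 / real n) - g (S (Suc k) x))
        + (S (Suc k) x - S (Suc (Suc k)) x) * (g (S (Suc k) x - 1 / real n) - g (S (Suc k) x))) = 0"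
    (is "E ?h = 0")
proof -
  have "0 = E (gen (\<lambda>x. g (S (Suc k) x)))"
    by (rule E_gen[symmetric]) (rule bounded_level)
  also have "\<dots> = E (\<lambda>x. real n * ?h x)"
    by (intro E_cong) (simp add: gen_level algebra_simps)
  finally show ?thesis using n_pos by simp
qed

lemma S_0: "x \<in> states \<Longrightarrow> S 0 x = 1"
  using n_pos by (cases x) (auto intro!: queue_fraction_0 dest: statesD)

lemma mean_level_tendsto_0: "(\<lambda>k. E (S k)) \<longlonglongrightarrow> 0"
proof -
  have "(\<lambda>k. E (S k)) \<longlonglongrightarrow> E (\<lambda>_. 0)"
    by (rule integral_dominated_convergence[where w="\<lambda>_. 1"])
      (auto intro!: AE_I2 queue_fraction_tendsto_0 simp: queue_fraction_nonneg queue_fraction_le_1)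
  then show ?thesis by simp
qed

text \<open>
  In equilibrium the flow into level \<open>k + 1\<close> minus the mean of that level does not depend on \<open>k\<close>.
  It tends to \<open>0\<close> as \<open>k \<rightarrow> \<infinity>\<close>, hence it vanishes for every \<open>k\<close>.
\<close>

lemma mean_level:
  "E (S (Suc k)) = lam * (E (\<lambda>x. no_token x * S k x) + (1 - E no_token) * of_bool (k = 0))"
proof -
  define a where "a k = lam * (E (\<lambda>x. no_token x * S k x) + (1 - E no_token) * of_bool (k = 0))" for k
  have step: "E (S (Suc k)) - a k = E (S (Suc (Suc k))) - a (Suc k)" for k
  proof -
    have "0 = E (\<lambda>x. up_rate k x * ((S (Suc k) x + 1 / real n) - S (Suc k) x)
        + (S (Suc k) x - S (Suc (Suc k)) x) * ((S (Suc k) x - 1 / real n) - S (Suc k) x))"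
      using level_balance[of k "\<lambda>s. s"] by simp
    also have "\<dots> = E (\<lambda>x. (up_rate k x - (S (Suc k) x - S (Suc (Suc k)) x)) / real n)"
      by (intro E_cong) (simp add: diff_divide_distrib)
    also have "\<dots> = E (\<lambda>x. up_rate k x - (S (Suc k) x - S (Suc (Suc k)) x)) / real n"
      by simp
    finally have "0 = E (\<lambda>x. up_rate k x - (S (Suc k) x - S (Suc (Suc k)) x))"
      using n_pos by simp
    also have "\<dots> = E (\<lambda>x. up_rate k x) - (E (S (Suc k)) - E (S (Suc (Suc k))))"
      unfolding up_rate_def by (subst E_diff E_diff[of "S _"], (intro bounded_intros)+)+ rule
    also have "E (\<lambda>x. up_rate k x) = E (\<lambda>x. lam * (no_token x * S k x - no_token x * S (Suc k) x + (1 - no_token x) * of_bool (k = 0)))"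
      by (simp add: up_rate_def algebra_simps)
    also have "\<dots> = lam * (E (\<lambda>x. no_token x * S k x) - E (\<lambda>x. no_token x * S (Suc k) x) + (1 - E no_token) * of_bool (k = 0))"
      by (simp add: integrable_bounded bounded_intros)
    also have "\<dots> = a k - a (Suc k)" by (simp add: a_def algebra_simps)
    finally show ?thesis by simp
  qed
  have base: "E (S (Suc j)) - a j = E (S (Suc 0)) - a 0" for j
  proof (induction j)
    case (Suc j)
    with step[of j] show ?case by argo
  qed argo
  have const: "(\<lambda>j. E (S (Suc j)) - a j) = (\<lambda>j. E (S (Suc k)) - a k)"
    by (rule ext) (rule trans[OF base base[symmetric]])
  have "(\<lambda>j. E (S (Suc j)) - a j) \<longlonglongrightarrow> 0"
  proof (rule tendsto_0_le[where K=2])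
    show "(\<lambda>j. E (S j)) \<longlonglongrightarrow> 0" by (rule mean_level_tendsto_0)
    show "\<forall>\<^sub>F j in sequentially. norm (E (S (Suc j)) - a j) \<le> norm (E (S j)) * 2"
      using eventually_gt_at_top[of 0]
    proof eventually_elim
      case (elim j)
      have "0 \<le> E (S (Suc j))" "0 \<le> E (\<lambda>x. no_token x * S j x)"
        by (auto intro!: integral_nonneg_AE simp: queue_fraction_nonneg)
      moreover have "E (S (Suc j)) \<le> E (S j)" "E (\<lambda>x. no_token x * S j x) \<le> E (S j)"
        by (auto intro!: E_mono bounded_intros simp: queue_fraction_Suc_le queue_fraction_nonneg)
      moreover have "lam * E (\<lambda>x. no_token x * S j x) \<le> E (\<lambda>x. no_token x * S j x)"
        using calculation lam_less lam_pos by (simp add: mult_left_le_one_le)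
      moreover have "0 \<le> lam * E (\<lambda>x. no_token x * S j x)"
        using calculation lam_pos by simp
      moreover have "a j = lam * E (\<lambda>x. no_token x * S j x)" using elim by (simp add: a_def)
      ultimately show ?case by simp
    qed
  qed
  moreover have "(\<lambda>j. E (S (Suc j)) - a j) \<longlonglongrightarrow> E (S (Suc k)) - a k"
    unfolding const by (rule tendsto_const)
  ultimately have "E (S (Suc k)) - a k = 0" using LIMSEQ_unique by blast
  then show ?thesis by (simp add: a_def)
qed

lemma mean_level_1: "E (S 1) = lam"
proof -
  have "E (\<lambda>x. no_token x * S 0 x) = E no_token"
    by (intro E_cong) (simp add: S_0)
  then show ?thesis using mean_level[of 0] by simp
qed

lemma mean_level_Suc: "E (S (Suc (Suc k))) = lam * E (\<lambda>x. no_token x * S (Suc k) x)"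
  using mean_level[of "Suc k"] by simp

lemma mean_level_nonneg: "0 \<le> E (S k)"
  by (auto intro!: integral_nonneg_AE simp: queue_fraction_nonneg)

text \<open>
  Uniformity in \<open>n\<close> is what later permits summing the levels before letting \<open>n \<rightarrow> \<infinity>\<close>.
\<close>

lemma mean_level_le: "E (S (Suc k)) \<le> lam ^ Suc k"
proof (induction k)
  case 0
  then show ?case using mean_level_1 by simp
next
  case (Suc k)
  have "E (\<lambda>x. no_token x * S (Suc k) x) \<le> E (S (Suc k))"
    by (auto intro!: E_mono bounded_intros simp: queue_fraction_nonneg)
  then have "lam * E (\<lambda>x. no_token x * S (Suc k) x) \<le> lam * lam ^ Suc k"
    using Suc lam_pos by (intro mult_left_mono) auto
  then show ?case by (simp only: mean_level_Suc power_Suc)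
qed

lemma mean_level_summable: "summable (\<lambda>k. E (S (Suc k)))"
proof (rule summable_comparison_test')
  show "summable (\<lambda>k. lam ^ Suc k)"
    using lam_pos lam_less by (simp only: summable_Suc_iff) (simp add: summable_geometric)
  show "norm (E (S (Suc k))) \<le> lam ^ Suc k" if "0 \<le> k" for k
    using mean_level_le[of k] mean_level_nonneg[of "Suc k"] by simp
qed

lemma queueing_delay_eq: "queueing_delay lam p = ereal ((\<Sum>k. E (S (Suc k))) / lam - 1)"
proof -
  have "(\<integral>\<^sup>+ x. (\<Sum>k. ennreal (S (Suc k) x)) \<partial>p) = (\<Sum>k. \<integral>\<^sup>+ x. ennreal (S (Suc k) x) \<partial>p)"
    by (rule nn_integral_suminf) simp
  also have "\<dots> = (\<Sum>k. ennreal (E (S (Suc k))))"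
    by (intro suminf_cong nn_integral_eq_integral integrable_bounded bounded_intros)
      (simp add: queue_fraction_nonneg)
  also have "\<dots> = ennreal (\<Sum>k. E (S (Suc k)))"
    by (intro suminf_ennreal2 mean_level_nonneg mean_level_summable)
  finally show ?thesis
    by (simp add: queueing_delay_def suminf_nonneg mean_level_nonneg mean_level_summable one_ereal_def)
qed

end

section \<open>Averaging out the tokens\<close>

text \<open>
  Functions of the queues that change by \<open>O(1/n)\<close> when one queue changes by one job. The queues
  jump at total rate \<open>O(n)\<close>, so such a function evolves at speed \<open>O(1)\<close>, whereas the number of
  tokens evolves at speed \<open>n\<close>. One constant for both bounds keeps the bookkeeping short.
\<close>

definition tame :: "nat \<Rightarrow> real \<Rightarrow> (nat list \<Rightarrow> real) \<Rightarrow> bool" where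
  "tame n B \<psi> \<longleftrightarrow> (\<forall>q. length q = n \<longrightarrow> \<bar>\<psi> q\<bar> \<le> B \<and>
     (\<forall>i<n. \<forall>v. v \<le> Suc (q ! i) \<longrightarrow> q ! i \<le> Suc v \<longrightarrow> \<bar>\<psi> (q[i := v]) - \<psi> q\<bar> \<le> B / real n))"

lemma tame_bound: "tame n B \<psi> \<Longrightarrow> length q = n \<Longrightarrow> \<bar>\<psi> q\<bar> \<le> B"
  by (auto simp: tame_def)

lemma tame_jump:
  "tame n B \<psi> \<Longrightarrow> length q = n \<Longrightarrow> i < n \<Longrightarrow> v \<le> Suc (q ! i) \<Longrightarrow> q ! i \<le> Suc v
    \<Longrightarrow> \<bar>\<psi> (q[i := v]) - \<psi> q\<bar> \<le> B / real n"
  by (auto simp: tame_def)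

lemma tame_nonneg: "tame n B \<psi> \<Longrightarrow> 0 \<le> B"
  using tame_bound[of n B \<psi> "replicate n 0"] by (simp add: order_trans[OF abs_ge_zero])

lemma abs_mult_diff_le:
  fixes a b a' b' :: real
  assumes "\<bar>a'\<bar> \<le> A" "\<bar>b\<bar> \<le> B" "\<bar>a' - a\<bar> \<le> A'" "\<bar>b' - b\<bar> \<le> B'"
  shows "\<bar>a' * b' - a * b\<bar> \<le> A * B' + A' * B"
proof -
  have "a' * b' - a * b = a' * (b' - b) + (a' - a) * b" by (simp add: algebra_simps)
  also have "\<bar>\<dots>\<bar> \<le> \<bar>a'\<bar> * \<bar>b' - b\<bar> + \<bar>a' - a\<bar> * \<bar>b\<bar>"
    using abs_triangle_ineq by (simp flip: abs_mult)
  also have "\<dots> \<le> A * B' + A' * B"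
    using assms by (intro add_mono mult_mono) (auto intro: order_trans[OF abs_ge_zero])
  finally show ?thesis .
qed

lemma tame_mult:
  assumes "tame n A f" "tame n B g"
  shows "tame n (2 * A * B) (\<lambda>q. f q * g q)"
proof -
  have AB: "0 \<le> A" "0 \<le> B" using assms tame_nonneg by blast+
  show ?thesis unfolding tame_def
  proof (intro allI impI conjI)
    fix q :: "nat list" assume q: "length q = n"
    have "\<bar>f q * g q\<bar> \<le> A * B"
      using tame_bound[OF assms(1) q] tame_bound[OF assms(2) q] AB by (simp add: abs_mult mult_mono)
    then show "\<bar>f q * g q\<bar> \<le> 2 * A * B" using mult_nonneg_nonneg[OF AB] by linarith
    fix i v assume iv: "i < n" "v \<le> Suc (q ! i)" "q ! i \<le> Suc v"
    have "\<bar>f (q[i := v]) * g (q[i := v]) - f q * g q\<bar> \<le> A * (B / real n) + A / real n * B"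
      by (intro abs_mult_diff_le tame_bound[OF assms(1)] tame_bound[OF assms(2)]
          tame_jump[OF assms(1)] tame_jump[OF assms(2)]) (use q iv in auto)
    then show "\<bar>f (q[i := v]) * g (q[i := v]) - f q * g q\<bar> \<le> 2 * A * B / real n"
      by (simp add: field_simps)
  qed
qed

lemma tame_level:
  assumes lip: "\<And>s t. 0 \<le> s \<Longrightarrow> s \<le> 1 \<Longrightarrow> 0 \<le> t \<Longrightarrow> t \<le> 1 \<Longrightarrow> \<bar>g s - g t\<bar> \<le> B * \<bar>s - t\<bar>"
    and bound: "\<And>s. 0 \<le> s \<Longrightarrow> s \<le> 1 \<Longrightarrow> \<bar>g s\<bar> \<le> B"
  shows "tame n B (\<lambda>q. g (queue_fraction q k))"
  unfolding tame_def
proof (intro allI impI conjI)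
  fix q :: "nat list" assume q: "length q = n"
  show "\<bar>g (queue_fraction q k)\<bar> \<le> B"
    by (intro bound queue_fraction_nonneg queue_fraction_le_1)
  have B: "0 \<le> B" using bound[of 0] by (simp add: order_trans[OF abs_ge_zero])
  fix i v assume iv: "i < n" "v \<le> Suc (q ! i)" "q ! i \<le> Suc v"
  have "\<bar>queue_fraction (q[i := v]) k - queue_fraction q k\<bar> \<le> 1 / real n"
    by (simp add: queue_fraction_update[OF iv(1) q])
  then have "B * \<bar>queue_fraction (q[i := v]) k - queue_fraction q k\<bar> \<le> B * (1 / real n)"
    using B by (rule mult_left_mono)
  with lip[of "queue_fraction (q[i := v]) k" "queue_fraction q k"]
  show "\<bar>g (queue_fraction (q[i := v]) k) - g (queue_fraction q k)\<bar> \<le> B / real n"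
    by (simp add: queue_fraction_nonneg queue_fraction_le_1)
qed

lemma tame_idle: "tame n 1 (\<lambda>q. 1 - queue_fraction q 1)"
  by (rule tame_level[of "\<lambda>s. 1 - s"]) auto

text \<open>
  For frozen queues with idle fraction \<open>x\<close> the number of tokens is nearly a birth-death chain on
  \<open>{0..c}\<close> with birth rate \<open>n * mu * x\<close> and death rate \<open>n * lam\<close>. The weight is its normalising
  constant for \<open>b = mu / lam\<close>, and \<open>no_token_prob b c s\<close> below is its stationary mass at \<open>0\<close> when
  the fraction \<open>s\<close> of the servers is busy.
\<close>

definition token_weight :: "real \<Rightarrow> nat \<Rightarrow> real \<Rightarrow> real" where
  "token_weight b c x = (\<Sum>k\<le>c. (b * x) ^ k)"

definition weight_lipschitz :: "real \<Rightarrow> nat \<Rightarrow> real" where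
  "weight_lipschitz b c = 1 + (\<Sum>k\<le>c. real k * b ^ k)"

lemma token_weight_ge_1: "0 \<le> b \<Longrightarrow> 0 \<le> x \<Longrightarrow> 1 \<le> token_weight b c x"
  unfolding token_weight_def using member_le_sum[of 0 "{..c}" "\<lambda>k. (b * x) ^ k"] by simp

lemma weight_lipschitz_ge_1: "0 \<le> b \<Longrightarrow> 1 \<le> weight_lipschitz b c"
  by (simp add: weight_lipschitz_def sum_nonneg)

lemma token_weight_diff:
  assumes b: "0 \<le> b" and x: "0 \<le> x" "x \<le> 1" and y: "0 \<le> y" "y \<le> 1"
  shows "\<bar>token_weight b c x - token_weight b c y\<bar> \<le> weight_lipschitz b c * \<bar>x - y\<bar>"
proof -
  have "token_weight b c x - token_weight b c y = (\<Sum>k\<le>c. b ^ k * (x ^ k - y ^ k))"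
    by (simp add: token_weight_def power_mult_distrib algebra_simps flip: sum_subtractf)
  also have "\<bar>\<dots>\<bar> \<le> (\<Sum>k\<le>c. b ^ k * (real k * \<bar>x - y\<bar>))"
  proof (rule order_trans[OF sum_abs], rule sum_mono)
    fix k
    have "\<bar>x ^ k - y ^ k\<bar> \<le> real k * \<bar>x - y\<bar>"
      using norm_power_diff[of x y k] x y by simp
    then show "\<bar>b ^ k * (x ^ k - y ^ k)\<bar> \<le> b ^ k * (real k * \<bar>x - y\<bar>)"
      using b by (simp add: abs_mult mult_left_mono)
  qed
  also have "\<dots> = (\<Sum>k\<le>c. real k * b ^ k) * \<bar>x - y\<bar>"
    by (subst sum_distrib_right) (simp add: mult_ac)
  also have "\<dots> \<le> weight_lipschitz b c * \<bar>x - y\<bar>"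
    by (intro mult_right_mono) (auto simp: weight_lipschitz_def)
  finally show ?thesis .
qed

definition no_token_prob :: "real \<Rightarrow> nat \<Rightarrow> real \<Rightarrow> real" where
  "no_token_prob b c s = 1 / token_weight b c (1 - s)"

lemma no_token_prob_pos: "0 \<le> b \<Longrightarrow> s \<le> 1 \<Longrightarrow> 0 < no_token_prob b c s"
  and no_token_prob_le_1: "0 \<le> b \<Longrightarrow> s \<le> 1 \<Longrightarrow> no_token_prob b c s \<le> 1"
  using token_weight_ge_1[of b "1 - s" c] by (auto simp: no_token_prob_def)

lemma no_token_prob_mono:
  assumes "0 \<le> b" "s \<le> t" "t \<le> 1"
  shows "no_token_prob b c s \<le> no_token_prob b c t"
proof -
  have "token_weight b c (1 - t) \<le> token_weight b c (1 - s)"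
    unfolding token_weight_def using assms by (intro sum_mono power_mono mult_left_mono) auto
  moreover have "1 \<le> token_weight b c (1 - t)" using assms by (intro token_weight_ge_1) auto
  ultimately show ?thesis by (simp add: no_token_prob_def frac_le)
qed

lemma no_token_prob_lipschitz:
  assumes b: "0 \<le> b" and s: "0 \<le> s" "s \<le> 1" and t: "0 \<le> t" "t \<le> 1"
  shows "\<bar>no_token_prob b c s - no_token_prob b c t\<bar> \<le> weight_lipschitz b c * \<bar>s - t\<bar>"
proof -
  let ?u = "token_weight b c (1 - s)" and ?v = "token_weight b c (1 - t)"
  have ge: "1 \<le> ?u" "1 \<le> ?v" using assms by (auto intro: token_weight_ge_1)
  then have "1 \<le> ?u * ?v" using mult_mono[of 1 ?u 1 ?v] by simp
  have "no_token_prob b c s - no_token_prob b c t = (?v - ?u) / (?u * ?v)"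
    using ge by (simp add: no_token_prob_def field_simps)
  also have "\<bar>\<dots>\<bar> \<le> \<bar>?v - ?u\<bar>"
    using \<open>1 \<le> ?u * ?v\<close> ge by (simp add: abs_divide divide_le_eq mult_le_cancel_left1)
  also have "\<dots> \<le> weight_lipschitz b c * \<bar>(1 - t) - (1 - s)\<bar>"
    using assms by (intro token_weight_diff) auto
  finally show ?thesis by simp
qed

text \<open>
  The summands \<open>lam\<close>, \<open>1\<close> and \<open>mu * c\<close> are the remainders from arrivals, departures and discarded
  messages when one token is added. The powers of \<open>2 * b\<close> arise from iterating this step: each
  brings a factor \<open>b\<close>, and multiplying by the idle fraction doubles the constant of a tame function.
\<close>

definition step_const :: "real \<Rightarrow> real \<Rightarrow> nat \<Rightarrow> real" where
  "step_const lam mu c = (lam + 1 + mu * real c) / lam"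

definition weight_const :: "real \<Rightarrow> real \<Rightarrow> nat \<Rightarrow> real" where
  "weight_const lam mu c = (\<Sum>k\<le>c. step_const lam mu c * (\<Sum>j<k. (2 * (mu / lam)) ^ j))"

definition averaging_const :: "real \<Rightarrow> real \<Rightarrow> nat \<Rightarrow> real" where
  "averaging_const lam mu c = 2 * weight_const lam mu c * weight_lipschitz (mu / lam) c"

context rcpb_chain
begin

abbreviation "b \<equiv> mu / lam"

lemma b_pos: "0 < b" using mu_pos lam_pos by simp

lemma averaging_const_nonneg: "0 \<le> averaging_const lam mu c"
  using mu_pos lam_pos weight_lipschitz_ge_1[of b c]
  by (auto simp: averaging_const_def weight_const_def step_const_def
      intro!: mult_nonneg_nonneg sum_nonneg divide_nonneg_nonneg)

lemma bounded_tame: "tame n B \<psi> \<Longrightarrow> state_bounded (\<lambda>x. \<psi> (fst x))"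
  by (rule state_boundedI[of _ B]) (auto dest: statesD intro: tame_bound)

lemma bounded_gen:
  assumes "state_bounded f"
  shows "state_bounded (gen f)"
proof -
  obtain B where B: "\<And>x. x \<in> states \<Longrightarrow> \<bar>f x\<bar> \<le> B"
    using assms unfolding state_bounded_def by blast
  have "state_bounded (jump_sum n c lam mu f)"
    by (rule state_boundedI, rule jump_sum_bound[of _ "max B 0"]) (use B in \<open>auto simp: le_max_iff_disj\<close>)
  moreover have "state_bounded (jump_sum n c lam mu (\<lambda>_. 1))"
    by (rule state_boundedI, rule jump_sum_bound[of _ 1]) auto
  ultimately show ?thesis
    unfolding generator_eq[abs_def] by (intro bounded_diff bounded_mult assms)
qed

lemma E_abs_le:
  fixes f :: "rcpb_state \<Rightarrow> real"
  assumes "\<And>x. x \<in> states \<Longrightarrow> \<bar>f x\<bar> \<le> B"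
  shows "\<bar>E f\<bar> \<le> B"
proof -
  have "state_bounded f" using assms by (rule state_boundedI)
  moreover have "f x \<le> B" "- B \<le> f x" if "x \<in> states" for x
    using assms[OF that] by auto
  ultimately have "E f \<le> E (\<lambda>_. B)" "E (\<lambda>_. - B) \<le> E f"
    by (blast intro: E_mono bounded_const)+
  then show ?thesis by simp
qed

lemma idle_count_level: "(q, m) \<in> states \<Longrightarrow> real (idle_count q) = real n * (1 - queue_fraction q 1)"
  using queue_fraction_diff[of q n 0] queue_fraction_0[of q] n_pos
  by (auto simp: idle_count_eq dest!: statesD(1))

text \<open>
  The leading part of the generator is the balance of the fast token chain across the cut between
  \<open>k\<close> and \<open>k + 1\<close> tokens. The remainder collects the motion of \<open>\<psi>\<close> under arrivals (\<open>e1\<close>) and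
  departures (\<open>e2\<close>), and the \<open>k\<close> idle servers whose messages are discarded because they already
  have a token stored (\<open>e3\<close>); none of these grows with \<open>n\<close>.
\<close>

lemma gen_token_level:
  assumes t: "tame n B \<psi>" and k: "k < c" and x: "x \<in> states"
  shows "\<bar>gen (\<lambda>x. \<psi> (fst x) * of_bool (k < snd x)) x
    - real n * (mu * (\<psi> (fst x) * (1 - S 1 x) * of_bool (snd x = k)) - lam * (\<psi> (fst x) * of_bool (snd x = Suc k)))\<bar>
    \<le> (lam + 1 + mu * real c) * B"
proof -
  obtain q m where x': "x = (q, m)" by (cases x)
  have xs: "(q, m) \<in> states" using x x' by simp
  have len: "length q = n" using statesD(1)[OF xs] .
  have B: "0 \<le> B" using tame_nonneg[OF t] .
  let ?a = "arrival_rate n lam (q, m)"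
  define e1 where "e1 = (\<Sum>i<n. ?a i * ((\<psi> (q[i := q ! i + 1]) - \<psi> q) * of_bool (k < m - 1)))"
  define e2 where "e2 = (\<Sum>i<n. of_bool (q ! i > 0) * ((\<psi> (q[i := q ! i - 1]) - \<psi> q) * of_bool (k < m)))"
  define e3 where "e3 = mu * real k * (\<psi> q * of_bool (m = k))"
  have "\<bar>e1\<bar> \<le> (\<Sum>i<n. ?a i * (B / real n))"
    unfolding e1_def
  proof (rule order_trans[OF sum_abs], rule sum_mono)
    fix i assume "i \<in> {..<n}"
    then have "\<bar>(\<psi> (q[i := q ! i + 1]) - \<psi> q) * of_bool (k < m - 1)\<bar> \<le> B / real n"
      using tame_jump[OF t len, of i "q ! i + 1"] B by auto
    then show "\<bar>?a i * ((\<psi> (q[i := q ! i + 1]) - \<psi> q) * of_bool (k < m - 1))\<bar> \<le> ?a i * (B / real n)"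
      unfolding abs_mult[of "?a i"] abs_of_nonneg[OF arrival_nonneg]
      by (rule mult_left_mono) (rule arrival_nonneg)
  qed
  also have "\<dots> = lam * B"
    using n_pos by (simp add: sum_arrival[OF xs] flip: sum_distrib_right sum_divide_distrib)
  finally have 1: "\<bar>e1\<bar> \<le> lam * B" .
  have "\<bar>e2\<bar> \<le> (\<Sum>i<n. B / real n)"
    unfolding e2_def
  proof (rule order_trans[OF sum_abs], rule sum_mono)
    fix i assume "i \<in> {..<n}"
    then show "\<bar>of_bool (q ! i > 0) * ((\<psi> (q[i := q ! i - 1]) - \<psi> q) * of_bool (k < m))\<bar> \<le> B / real n"
      using tame_jump[OF t len, of i "q ! i - 1"] B by auto
  qed
  then have 2: "\<bar>e2\<bar> \<le> B" using n_pos by simp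
  have "\<bar>\<psi> q * of_bool (m = k)\<bar> \<le> B"
    using tame_bound[OF t len] B by auto
  then have 3: "\<bar>e3\<bar> \<le> mu * real c * B"
    using k mu_pos unfolding e3_def abs_mult[of "mu * real k"] by (intro mult_mono) auto
  have "(\<Sum>i<n. ?a i * (\<psi> (q[i := q ! i + 1]) * of_bool (k < m - 1) - \<psi> q * of_bool (k < m)))
      = (\<Sum>i<n. ?a i * ((\<psi> (q[i := q ! i + 1]) - \<psi> q) * of_bool (k < m - 1)) - ?a i * (\<psi> q * of_bool (m = Suc k)))"
    by (intro sum.cong) (auto simp: algebra_simps)
  also have "\<dots> = e1 - (\<Sum>i<n. ?a i) * (\<psi> q * of_bool (m = Suc k))"
    unfolding sum_subtractf sum_distrib_right e1_def ..
  finally have A: "(\<Sum>i<n. ?a i * (\<psi> (q[i := q ! i + 1]) * of_bool (k < m - 1) - \<psi> q * of_bool (k < m)))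
      = e1 - real n * lam * (\<psi> q * of_bool (m = Suc k))"
    unfolding sum_arrival[OF xs] .
  have Dp: "(\<Sum>i<n. of_bool (q ! i > 0) * (\<psi> (q[i := q ! i - 1]) * of_bool (k < m) - \<psi> q * of_bool (k < m))) = e2"
    unfolding e2_def by (intro sum.cong) (auto simp: algebra_simps)
  have M: "message_rate c mu (q, m) * (\<psi> q * of_bool (k < m + 1) - \<psi> q * of_bool (k < m))
      = real n * (mu * (\<psi> q * (1 - queue_fraction q 1) * of_bool (m = k))) - e3"
    using k by (auto simp: message_rate_def idle_count_level[OF xs] e3_def algebra_simps)
  show ?thesis
    unfolding x' generator_def prod.case fst_conv snd_conv A Dp M
    using 1 2 3 by (simp add: algebra_simps)
qed

lemma token_step:
  assumes t: "tame n B \<psi>" and k: "k < c"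
  shows "\<bar>E (\<lambda>x. \<psi> (fst x) * of_bool (snd x = Suc k)) - b * E (\<lambda>x. \<psi> (fst x) * (1 - S 1 x) * of_bool (snd x = k))\<bar>
    \<le> step_const lam mu c * B / real n"
proof -
  note bt = bounded_tame[OF t]
  let ?f = "\<lambda>x. \<psi> (fst x) * of_bool (k < snd x)"
  let ?u = "\<lambda>x. \<psi> (fst x) * (1 - S 1 x) * of_bool (snd x = k)"
  let ?v = "\<lambda>x. \<psi> (fst x) * of_bool (snd x = Suc k)"
  have bu: "state_bounded ?u" and bv: "state_bounded ?v" and bf: "state_bounded ?f"
    by (intro bounded_mult bt bounded_intros)+
  have "E (\<lambda>x. gen ?f x - real n * (mu * ?u x - lam * ?v x))
      = E (gen ?f) - real n * (mu * E ?u - lam * E ?v)"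
    using integrable_bounded[OF bu] integrable_bounded[OF bv] integrable_bounded[OF bounded_gen[OF bf]]
    by simp
  also have "\<dots> = - real n * (mu * E ?u - lam * E ?v)" using E_gen[OF bf] by simp
  finally have "\<bar>real n * (mu * E ?u - lam * E ?v)\<bar> \<le> (lam + 1 + mu * real c) * B"
    using E_abs_le[of "\<lambda>x. gen ?f x - real n * (mu * ?u x - lam * ?v x)", OF gen_token_level[OF t k]]
    by simp
  moreover have eq: "real n * (mu * E ?u - lam * E ?v) = - ((real n * lam) * (E ?v - b * E ?u))"
    using lam_pos by (simp add: field_simps)
  have "\<bar>real n * (mu * E ?u - lam * E ?v)\<bar> = (real n * lam) * \<bar>E ?v - b * E ?u\<bar>"
    unfolding eq abs_minus_cancel abs_mult[of "real n * lam"] using lam_pos by simp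
  ultimately have "(real n * lam) * \<bar>E ?v - b * E ?u\<bar> \<le> (lam + 1 + mu * real c) * B"
    by linarith
  then show ?thesis using n_pos lam_pos by (simp add: step_const_def field_simps)
qed

text \<open>
  The factor \<open>1 - S 1\<close> produced by one step is itself tame, so the step can be repeated with
  \<open>\<psi> * (1 - S 1)\<close> in place of \<open>\<psi>\<close>.
\<close>

lemma token_power:
  assumes "tame n B \<psi>" and "k \<le> c"
  shows "\<bar>E (\<lambda>x. \<psi> (fst x) * of_bool (snd x = k)) - b ^ k * E (\<lambda>x. \<psi> (fst x) * (1 - S 1 x) ^ k * no_token x)\<bar>
    \<le> step_const lam mu c * (\<Sum>j<k. (2 * b) ^ j) * B / real n"
  using assms
proof (induction k arbitrary: \<psi> B)
  case (Suc k)
  let ?D = "step_const lam mu c"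
  let ?\<psi> = "\<lambda>q. \<psi> q * (1 - queue_fraction q 1)"
  have t: "tame n (2 * B) ?\<psi>" using tame_mult[OF Suc.prems(1) tame_idle] by simp
  have IH: "\<bar>E (\<lambda>x. ?\<psi> (fst x) * of_bool (snd x = k)) - b ^ k * E (\<lambda>x. ?\<psi> (fst x) * (1 - S 1 x) ^ k * no_token x)\<bar>
    \<le> ?D * (\<Sum>j<k. (2 * b) ^ j) * (2 * B) / real n"
    using Suc.IH[OF t] Suc.prems by simp
  have st: "\<bar>E (\<lambda>x. \<psi> (fst x) * of_bool (snd x = Suc k)) - b * E (\<lambda>x. ?\<psi> (fst x) * of_bool (snd x = k))\<bar>
      \<le> ?D * B / real n"
    using token_step[OF Suc.prems(1)] Suc.prems(2) by simp
  define u v w where "u = E (\<lambda>x. \<psi> (fst x) * of_bool (snd x = Suc k))"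
    and "v = E (\<lambda>x. ?\<psi> (fst x) * of_bool (snd x = k))"
    and "w = E (\<lambda>x. ?\<psi> (fst x) * (1 - S 1 x) ^ k * no_token x)"
  have w: "E (\<lambda>x. \<psi> (fst x) * (1 - S 1 x) ^ Suc k * no_token x) = w"
    by (simp add: w_def mult_ac)
  have "\<bar>u - b ^ Suc k * w\<bar> \<le> \<bar>u - b * v\<bar> + \<bar>b * v - b * (b ^ k * w)\<bar>"
  proof -
    have "u - b ^ Suc k * w = (u - b * v) + (b * v - b * (b ^ k * w))"
      by (simp only: power_Suc mult.assoc add_diff_eq diff_add_cancel)
    then show ?thesis by (metis abs_triangle_ineq)
  qed
  also have "\<bar>b * v - b * (b ^ k * w)\<bar> = b * \<bar>v - b ^ k * w\<bar>"
    using b_pos by (simp only: abs_mult right_diff_distrib[symmetric] abs_of_pos)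
  also have "\<bar>u - b * v\<bar> + b * \<bar>v - b ^ k * w\<bar>
      \<le> ?D * B / real n + b * (?D * (\<Sum>j<k. (2 * b) ^ j) * (2 * B) / real n)"
    using st IH b_pos unfolding u_def v_def w_def by (intro add_mono mult_left_mono) auto
  also have "\<dots> = ?D * (1 + (2 * b) * (\<Sum>j<k. (2 * b) ^ j)) * B / real n"
    by (simp add: algebra_simps add_divide_distrib)
  also have "1 + (2 * b) * (\<Sum>j<k. (2 * b) ^ j) = (\<Sum>j<Suc k. (2 * b) ^ j)"
    by (subst sum.lessThan_Suc_shift) (simp add: sum_distrib_left)
  finally show ?case unfolding w u_def .
qed simp

lemma token_average:
  assumes t: "tame n B \<psi>"
  shows "\<bar>E (\<lambda>x. \<psi> (fst x)) - E (\<lambda>x. \<psi> (fst x) * token_weight b c (1 - S 1 x) * no_token x)\<bar>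
    \<le> weight_const lam mu c * B / real n"
proof -
  note bt = bounded_tame[OF t]
  let ?u = "\<lambda>k x. \<psi> (fst x) * of_bool (snd x = k)"
  let ?v = "\<lambda>k x. \<psi> (fst x) * (1 - S 1 x) ^ k * no_token x"
  have bu: "state_bounded (?u k)" and bv: "state_bounded (?v k)" for k
    by (intro bounded_mult bt bounded_intros)+
  have "E (\<lambda>x. \<psi> (fst x)) = E (\<lambda>x. \<Sum>k\<le>c. ?u k x)"
    by (intro E_cong) (auto dest: statesD simp flip: sum_distrib_left)
  also have "\<dots> = (\<Sum>k\<le>c. E (?u k))" by (intro E_sum bu)
  finally have 1: "E (\<lambda>x. \<psi> (fst x)) = (\<Sum>k\<le>c. E (?u k))" .
  have "E (\<lambda>x. \<psi> (fst x) * token_weight b c (1 - S 1 x) * no_token x) = E (\<lambda>x. \<Sum>k\<le>c. b ^ k * ?v k x)"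
    by (simp only: token_weight_def sum_distrib_left sum_distrib_right power_mult_distrib mult_ac)
  also have "\<dots> = (\<Sum>k\<le>c. E (\<lambda>x. b ^ k * ?v k x))"
    by (intro E_sum bounded_mult[OF bounded_const] bv)
  finally have 2: "E (\<lambda>x. \<psi> (fst x) * token_weight b c (1 - S 1 x) * no_token x) = (\<Sum>k\<le>c. b ^ k * E (?v k))"
    by simp
  have "\<bar>(\<Sum>k\<le>c. E (?u k)) - (\<Sum>k\<le>c. b ^ k * E (?v k))\<bar>
      \<le> (\<Sum>k\<le>c. step_const lam mu c * (\<Sum>j<k. (2 * b) ^ j) * B / real n)"
    unfolding sum_subtractf[symmetric]
    by (rule order_trans[OF sum_abs], rule sum_mono, rule token_power[OF t]) simp
  then show ?thesis
    unfolding 1 2 by (simp add: weight_const_def sum_distrib_right sum_divide_distrib)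
qed

text \<open>
  Applying the averaged balance to \<open>\<psi>\<close> divided by the weight turns it into a statement on the
  indicator of having no token, which may then be replaced by a function of \<open>S 1\<close>.
\<close>

lemma no_token_average:
  assumes t: "tame n B \<psi>"
  shows "\<bar>E (\<lambda>x. \<psi> (fst x) * no_token_prob b c (S 1 x)) - E (\<lambda>x. \<psi> (fst x) * no_token x)\<bar>
    \<le> averaging_const lam mu c * B / real n"
proof -
  have "tame n (weight_lipschitz b c) (\<lambda>q. no_token_prob b c (queue_fraction q 1))"
  proof (rule tame_level)
    fix s :: real assume s: "0 \<le> s" "s \<le> 1"
    show "\<bar>no_token_prob b c s\<bar> \<le> weight_lipschitz b c"
      using no_token_prob_pos[of b s c] no_token_prob_le_1[of b s c] weight_lipschitz_ge_1[of b c] b_pos s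
      by simp
  qed (use b_pos in \<open>auto intro: no_token_prob_lipschitz\<close>)
  from token_average[OF tame_mult[OF t this]]
  have "\<bar>E (\<lambda>x. \<psi> (fst x) * no_token_prob b c (S 1 x))
      - E (\<lambda>x. \<psi> (fst x) * no_token_prob b c (S 1 x) * token_weight b c (1 - S 1 x) * no_token x)\<bar>
    \<le> weight_const lam mu c * (2 * B * weight_lipschitz b c) / real n" .
  moreover have "no_token_prob b c (S 1 x) * token_weight b c (1 - S 1 x) = 1" for x
    using token_weight_ge_1[of b "1 - S 1 x" c] b_pos queue_fraction_le_1[of "fst x" 1]
    by (simp add: no_token_prob_def)
  ultimately show ?thesis
    by (simp add: averaging_const_def mult_ac)
qed

end

section \<open>Concentration of the busy fraction\<close>

definition ramp :: "real \<Rightarrow> real \<Rightarrow> real" where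
  "ramp e x = max 0 (min 1 (x / e))"

text \<open>
  A smoothing of the positive part at scale \<open>e\<close>, with derivative \<open>ramp e\<close>. Written in this way it is
  visibly the maximum of \<open>v * x - e * v\<^sup>2 / 2\<close> over \<open>0 \<le> v \<le> 1\<close>, attained at \<open>v = ramp e x\<close>, which
  yields convexity and the second-order upper bound without differentiation.
\<close>

definition huber :: "real \<Rightarrow> real \<Rightarrow> real" where
  "huber e x = ramp e x * x - e * (ramp e x)\<^sup>2 / 2"

lemma ramp_range: "0 \<le> ramp e x" "ramp e x \<le> 1"
  by (auto simp: ramp_def)

lemma ramp_nonpos: "0 < e \<Longrightarrow> x \<le> 0 \<Longrightarrow> ramp e x = 0"
  and ramp_large: "0 < e \<Longrightarrow> e \<le> x \<Longrightarrow> ramp e x = 1"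
  by (auto simp: ramp_def max_def min_def divide_simps)

lemma ramp_lipschitz:
  assumes "0 < e"
  shows "\<bar>ramp e x - ramp e y\<bar> \<le> 1 / e * \<bar>x - y\<bar>"
proof -
  have "\<bar>ramp e x - ramp e y\<bar> \<le> \<bar>x / e - y / e\<bar>"
    by (auto simp: ramp_def max_def min_def abs_if)
  also have "\<dots> = 1 / e * \<bar>x - y\<bar>"
    using assms by (simp add: abs_divide flip: diff_divide_distrib)
  finally show ?thesis .
qed

text \<open>
  Strong concavity in \<open>v\<close>: the defect from the maximum is at least quadratic. The inequality reduces
  to the first-order optimality condition at \<open>ramp e x\<close>.
\<close>

lemma huber_maximal:
  assumes e: "0 < e" and v: "0 \<le> v" "v \<le> 1"
  shows "v * x - e * v\<^sup>2 / 2 + e * (v - ramp e x)\<^sup>2 / 2 \<le> huber e x"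
proof -
  let ?w = "ramp e x"
  have "(v - ?w) * (x - e * ?w) \<le> 0"
  proof -
    consider "x \<le> 0" | "0 < x" "x < e" | "e \<le> x" by linarith
    then show ?thesis
    proof cases
      case 1
      then show ?thesis using e v by (simp add: ramp_nonpos mult_nonneg_nonpos)
    next
      case 2
      then have "?w = x / e" using e by (simp add: ramp_def max_def min_def divide_simps)
      then show ?thesis using e by simp
    next
      case 3
      then show ?thesis using e v by (simp add: ramp_large mult_nonpos_nonneg)
    qed
  qed
  then show ?thesis by (simp add: huber_def power2_eq_square algebra_simps) argo
qed

lemma huber_convex:
  assumes "0 < e"
  shows "huber e x + ramp e x * (y - x) \<le> huber e y"
proof -
  have "0 \<le> e * (ramp e x - ramp e y)\<^sup>2 / 2" using assms by simp
  moreover have "ramp e x * y - e * (ramp e x)\<^sup>2 / 2 + e * (ramp e x - ramp e y)\<^sup>2 / 2 \<le> huber e y"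
    by (intro huber_maximal assms ramp_range)
  ultimately show ?thesis by (simp add: huber_def[of e x] right_diff_distrib)
qed

lemma huber_upper:
  assumes "0 < e"
  shows "huber e (x + h) \<le> huber e x + ramp e x * h + h\<^sup>2 / (2 * e)"
proof -
  let ?v = "ramp e (x + h)" and ?w = "ramp e x"
  have "?v * x - e * ?v\<^sup>2 / 2 + e * (?v - ?w)\<^sup>2 / 2 \<le> huber e x"
    by (intro huber_maximal assms ramp_range)
  moreover have "(?v - ?w) * h - e * (?v - ?w)\<^sup>2 / 2 \<le> h\<^sup>2 / (2 * e)"
  proof -
    have "0 \<le> (h - e * (?v - ?w))\<^sup>2 / (2 * e)" using assms by simp
    also have "\<dots> = h\<^sup>2 / (2 * e) - ((?v - ?w) * h - e * (?v - ?w)\<^sup>2 / 2)"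
      using assms by (simp add: power2_eq_square field_simps)
    finally show ?thesis by simp
  qed
  moreover have "huber e (x + h) = ?v * x + ?v * h - e * ?v\<^sup>2 / 2"
    by (simp add: huber_def distrib_left)
  ultimately show ?thesis
    unfolding left_diff_distrib by linarith
qed

lemma huber_0: "huber e 0 = 0"
  by (simp add: huber_def ramp_def)

lemma huber_ge:
  assumes "0 < e"
  shows "0 \<le> huber e x" "x - e \<le> huber e x"
proof -
  have "0 \<le> e * (0 - ramp e x)\<^sup>2 / 2" "0 \<le> e * (1 - ramp e x)\<^sup>2 / 2" using assms by auto
  moreover have "0 + e * (0 - ramp e x)\<^sup>2 / 2 \<le> huber e x"
    "x - e / 2 + e * (1 - ramp e x)\<^sup>2 / 2 \<le> huber e x"
    using huber_maximal[OF assms, of 0 x] huber_maximal[OF assms, of 1 x] by simp_all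
  ultimately show "0 \<le> huber e x" "x - e \<le> huber e x"
    using assms by linarith+
qed

lemma huber_le:
  assumes "0 < e" "x \<le> y" "0 \<le> y"
  shows "huber e x \<le> y"
proof -
  have "0 \<le> e * (ramp e x)\<^sup>2 / 2" using assms by simp
  moreover have "ramp e x * x \<le> ramp e x * y" using assms ramp_range by (intro mult_left_mono)
  moreover have "ramp e x * y \<le> y" using assms ramp_range by (simp add: mult_left_le_one_le)
  ultimately show ?thesis by (simp add: huber_def)
qed

lemma tame_weighted_sum:
  fixes a :: "nat \<Rightarrow> real"
  assumes t: "\<And>k. tame n B (f k)" and a: "(\<Sum>k<K. \<bar>a k\<bar>) \<le> A"
  shows "tame n (A * B) (\<lambda>q. \<Sum>k<K. f k q * a k)"
proof -
  have B: "0 \<le> B" using tame_nonneg[OF t] .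
  have bound: "\<bar>\<Sum>k<K. u k * a k\<bar> \<le> A * C" if "\<And>k. \<bar>u k\<bar> \<le> C" "0 \<le> C" for u :: "nat \<Rightarrow> real" and C
  proof -
    have "\<bar>\<Sum>k<K. u k * a k\<bar> \<le> (\<Sum>k<K. \<bar>a k\<bar> * C)"
    proof (rule order_trans[OF sum_abs], rule sum_mono)
      fix k
      show "\<bar>u k * a k\<bar> \<le> \<bar>a k\<bar> * C"
        using mult_right_mono[OF that(1)[of k], of "\<bar>a k\<bar>"] by (simp add: abs_mult mult.commute)
    qed
    also have "\<dots> \<le> A * C" using a that by (simp add: mult_right_mono flip: sum_distrib_right)
    finally show ?thesis .
  qed
  show ?thesis unfolding tame_def
  proof (intro allI impI conjI)
    fix q :: "nat list" assume q: "length q = n"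
    show "\<bar>\<Sum>k<K. f k q * a k\<bar> \<le> A * B" by (intro bound tame_bound[OF t] q B)
    fix i v assume "i < n" "v \<le> Suc (q ! i)" "q ! i \<le> Suc v"
    then have "\<bar>\<Sum>k<K. (f k (q[i := v]) - f k q) * a k\<bar> \<le> A * (B / real n)"
      using B by (intro bound tame_jump[OF t] q) auto
    then show "\<bar>(\<Sum>k<K. f k (q[i := v]) * a k) - (\<Sum>k<K. f k q * a k)\<bar> \<le> A * B / real n"
      by (simp add: sum_subtractf left_diff_distrib)
  qed
qed

text \<open>
  The drift of \<open>\<Sum>k. huber e (s k - r k)\<close> along the mean-field dynamics, where \<open>r\<close> is the equilibrium
  for the no-token probability \<open>P\<close>. After subtracting the equilibrium equations, the terms linear in
  the deviations \<open>s - r\<close> telescope by convexity of \<open>huber\<close>. The arrival part contributes nothing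
  positive because \<open>s 0 = r 0\<close>, the departure part leaves the dissipation at level 1 and a boundary term
  at the truncation level. What remains is the effect of \<open>z\<close> differing from \<open>P\<close>.
\<close>

lemma drift_inequality:
  fixes s r :: "nat \<Rightarrow> real" and lam P z e :: real
  assumes e: "0 < e" and lam: "0 \<le> lam" and z: "0 \<le> z" and s0: "s 0 = r 0"
    and eq: "\<And>k. lam * (P * (r k - r (Suc k)) + (1 - P) * of_bool (k = 0)) = r (Suc k) - r (Suc (Suc k))"
  shows "(\<Sum>k<K. ramp e (s (Suc k) - r (Suc k)) *
            (lam * (z * (s k - s (Suc k)) + (1 - z) * of_bool (k = 0)) - (s (Suc k) - s (Suc (Suc k)))))
    \<le> lam * ((z - P) * (\<Sum>k<K. ramp e (s (Suc k) - r (Suc k)) * (r k - r (Suc k) - of_bool (k = 0))))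
      - huber e (s 1 - r 1) + huber e (s (Suc K) - r (Suc K))" (is "?L \<le> _")
proof -
  define d where "d k = s k - r k" for k
  define w where "w k = ramp e (d (Suc k))" for k
  define h where "h k = huber e (d k)" for k
  have 1: "w k * (d j - d (Suc k)) \<le> h j - h (Suc k)" for k j
    using huber_convex[OF e, of "d (Suc k)" "d j"] by (simp add: w_def h_def)
  have "?L = (\<Sum>k<K. w k *
            (lam * (z * (s k - s (Suc k)) + (1 - z) * of_bool (k = 0)) - (s (Suc k) - s (Suc (Suc k)))))"
    by (simp add: w_def d_def)
  also have "\<dots> \<le> (\<Sum>k<K. lam * ((z - P) * (w k * (r k - r (Suc k) - of_bool (k = 0))))
        + lam * z * (h k - h (Suc k)) + (h (Suc (Suc k)) - h (Suc k)))"
  proof (rule sum_mono)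
    fix k :: nat
    let ?i = "of_bool (k = 0) :: real"
    have "lam * (z * (s k - s (Suc k)) + (1 - z) * ?i) - (s (Suc k) - s (Suc (Suc k)))
        = lam * (z * (s k - s (Suc k)) + (1 - z) * ?i) - (s (Suc k) - s (Suc (Suc k)))
          - (lam * (P * (r k - r (Suc k)) + (1 - P) * ?i) - (r (Suc k) - r (Suc (Suc k))))"
      using eq[of k] by simp
    also have "\<dots> = lam * ((z - P) * (r k - r (Suc k) - ?i)) + lam * z * (d k - d (Suc k)) + (d (Suc (Suc k)) - d (Suc k))"
      by (simp add: d_def algebra_simps)
    finally have "w k * (lam * (z * (s k - s (Suc k)) + (1 - z) * ?i) - (s (Suc k) - s (Suc (Suc k))))
        = lam * ((z - P) * (w k * (r k - r (Suc k) - ?i))) + lam * z * (w k * (d k - d (Suc k)))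
          + w k * (d (Suc (Suc k)) - d (Suc k))"
      by (simp only: ) (simp only: distrib_left mult_ac)
    also have "\<dots> \<le> lam * ((z - P) * (w k * (r k - r (Suc k) - ?i))) + lam * z * (h k - h (Suc k))
          + (h (Suc (Suc k)) - h (Suc k))"
      using lam z by (intro add_mono mult_left_mono 1 order_refl mult_nonneg_nonneg)
    finally show "w k * (lam * (z * (s k - s (Suc k)) + (1 - z) * ?i) - (s (Suc k) - s (Suc (Suc k))))
      \<le> lam * ((z - P) * (w k * (r k - r (Suc k) - ?i))) + lam * z * (h k - h (Suc k))
          + (h (Suc (Suc k)) - h (Suc k))" .
  qed
  also have "\<dots> = lam * ((z - P) * (\<Sum>k<K. w k * (r k - r (Suc k) - of_bool (k = 0))))
      + lam * z * (h 0 - h K) + (h (Suc K) - h 1)"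
    unfolding sum.distrib sum_distrib_left[symmetric] sum_lessThan_telescope'
    by (simp only: sum_lessThan_telescope[of "\<lambda>k. h (Suc k)"] One_nat_def)
  also have "lam * z * (h 0 - h K) \<le> 0"
    using lam z s0 huber_ge(1)[OF e, of "d K"] by (simp add: h_def d_def huber_0 mult_nonneg_nonpos)
  finally show ?thesis by (simp add: w_def h_def d_def)
qed

text \<open>
  The constant does not depend on \<open>n\<close>; hence \<open>recursion_error\<close> decays like \<open>1 / sqrt n\<close>.
\<close>

definition concentration_const :: "real \<Rightarrow> real \<Rightarrow> nat \<Rightarrow> real" where
  "concentration_const lam mu c
    = 2 * weight_lipschitz (mu / lam) c + 4 * averaging_const lam mu c + 4"

definition recursion_error :: "real \<Rightarrow> real \<Rightarrow> nat \<Rightarrow> nat \<Rightarrow> real" where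
  "recursion_error lam mu c n =
     weight_lipschitz (mu / lam) c * (concentration_const lam mu c / sqrt (real n))
     + averaging_const lam mu c / real n"

context rcpb_chain
begin

abbreviation "P \<equiv> no_token_prob b c lam"

abbreviation "L \<equiv> weight_lipschitz b c"

abbreviation "A \<equiv> averaging_const lam mu c"

text \<open>
  The fixed point of the mean-field dynamics when the no-token probability is \<open>P\<close>. From level 1 on,
  the arrivals to be balanced come at \<open>lam * P\<close> per queue, which makes it geometric with that ratio;
  the value at index \<open>0\<close> is the boundary value \<open>S 0 = 1\<close>.
\<close>

fun eql :: "nat \<Rightarrow> real" where
  "eql 0 = 1"
| "eql (Suc k) = lam * (lam * P) ^ k"

lemma P_pos: "0 < P" and P_le_1: "P \<le> 1"
  using no_token_prob_pos[of b lam c] no_token_prob_le_1[of b lam c] b_pos lam_less by auto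

lemma lam_P: "0 < lam * P" "lam * P < 1"
proof -
  have "lam * P \<le> lam" using P_pos P_le_1 lam_pos by simp
  then show "lam * P < 1" using lam_less by linarith
  show "0 < lam * P" using P_pos lam_pos by simp
qed

lemma eql_balance:
  "lam * (P * (eql k - eql (Suc k)) + (1 - P) * of_bool (k = 0)) = eql (Suc k) - eql (Suc (Suc k))"
  by (cases k) (simp_all add: eql.simps algebra_simps)

declare eql.simps(2) [simp del]

lemma eql_pos: "0 < eql k"
  using lam_pos lam_P by (cases k) (auto simp: eql.simps)

lemma eql_decreasing: "eql (Suc k) \<le> eql k"
  using lam_pos lam_less lam_P by (cases k) (auto simp: eql.simps mult_le_cancel_right2)

lemma sum_eql: "(\<Sum>k<K. eql k - eql (Suc k)) \<le> 1"
  unfolding sum_lessThan_telescope' using eql_pos[of K] by simp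

text \<open>
  The factor multiplying \<open>z - P\<close> in the drift inequality.
\<close>

definition flux_gap :: "real \<Rightarrow> nat \<Rightarrow> nat list \<Rightarrow> real" where
  "flux_gap e K q = (\<Sum>k<K. ramp e (queue_fraction q (Suc k) - eql (Suc k)) * (eql k - eql (Suc k) - of_bool (k = 0)))"

lemma flux_gap_tame:
  assumes e: "0 < e" "e \<le> 1"
  shows "tame n (2 * (1 / e)) (flux_gap e K)"
proof -
  have "(\<Sum>k<K. \<bar>eql k - eql (Suc k) - of_bool (k = 0)\<bar>) \<le> (\<Sum>k<K. (eql k - eql (Suc k)) + of_bool (k = 0))"
    using eql_decreasing by (intro sum_mono) (smt (verit) of_bool_def)
  also have "\<dots> = (\<Sum>k<K. (eql k - eql (Suc k))) + (\<Sum>k<K. of_bool (k = 0))"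
    by (rule sum.distrib)
  also have "(\<Sum>k<K. of_bool (k = 0) :: real) \<le> 1"
    by (simp add: of_bool_def sum.delta')
  finally have "(\<Sum>k<K. \<bar>eql k - eql (Suc k) - of_bool (k = 0)\<bar>) \<le> 2" using sum_eql[of K] by linarith
  moreover have "tame n (1 / e) (\<lambda>q. ramp e (queue_fraction q (Suc k) - eql (Suc k)))" for k
  proof (rule tame_level[of "\<lambda>s. ramp e (s - eql (Suc k))"])
    fix s t :: real
    show "\<bar>ramp e (s - eql (Suc k)) - ramp e (t - eql (Suc k))\<bar> \<le> 1 / e * \<bar>s - t\<bar>"
      using ramp_lipschitz[OF e(1), of "s - eql (Suc k)" "t - eql (Suc k)"] by simp
    show "\<bar>ramp e (s - eql (Suc k))\<bar> \<le> 1 / e"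
    proof -
      have "1 \<le> 1 / e" using e by simp
      then show ?thesis using ramp_range[of e "s - eql (Suc k)"] by linarith
    qed
  qed
  ultimately show ?thesis
    unfolding flux_gap_def[abs_def] by (intro tame_weighted_sum)
qed

text \<open>
  This is where cooperativity enters. If the busy fraction exceeds \<open>lam\<close> by at least \<open>e\<close>, the no-token
  probability is above \<open>P\<close> and moves arrivals away from level 1, whose weight is maximal, so the
  Lyapunov function cannot grow; if the busy fraction is below \<open>lam\<close>, level 1 has weight \<open>0\<close> and
  the signs are reversed. Only the window of width \<open>e\<close> contributes, and there the Lipschitz bound
  applies.
\<close>

lemma flux_gap_correction:
  assumes e: "0 < e" and K: "1 \<le> K"
  shows "flux_gap e K (fst x) * no_token_prob b c (S 1 x) - P * flux_gap e K (fst x) \<le> L * e"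
proof -
  let ?d = "S 1 x - lam" and ?w = "\<lambda>k. ramp e (S (Suc k) x - eql (Suc k))"
  define Q where "Q = (\<Sum>k<K. ?w k * (eql k - eql (Suc k)))"
  have "flux_gap e K (fst x) = Q - (\<Sum>k<K. ?w k * of_bool (k = 0))"
    by (simp add: flux_gap_def Q_def right_diff_distrib sum_subtractf)
  also have "(\<Sum>k<K. ?w k * of_bool (k = 0)) = (\<Sum>k<K. if k = 0 then ?w k else 0)"
    by (intro sum.cong) auto
  also have "\<dots> = ramp e ?d" using K by (simp add: sum.delta eql.simps)
  finally have G: "flux_gap e K (fst x) = Q - ramp e ?d" .
  have Q0: "0 \<le> Q"
    unfolding Q_def using eql_decreasing by (intro sum_nonneg mult_nonneg_nonneg ramp_range) simp
  have "Q \<le> (\<Sum>k<K. eql k - eql (Suc k))"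
    unfolding Q_def using eql_decreasing
    by (intro sum_mono mult_left_le_one_le ramp_range) simp
  then have Q1: "Q \<le> 1" using sum_eql[of K] by linarith
  have S1: "0 \<le> S 1 x" "S 1 x \<le> 1" by (simp_all only: queue_fraction_nonneg queue_fraction_le_1)
  let ?D = "no_token_prob b c (S 1 x) - P"
  have LL: "0 \<le> L" using weight_lipschitz_ge_1[of b c] b_pos by simp
  have "?D * (Q - ramp e ?d) \<le> L * e"
  proof -
    consider "?d \<le> 0" | "0 < ?d" "?d < e" | "e \<le> ?d" by linarith
    then show ?thesis
    proof cases
      case 1
      then have "?D \<le> 0" using no_token_prob_mono[of b "S 1 x" lam c] b_pos lam_less by simp
      then have "?D * (Q - ramp e ?d) \<le> 0"
        using ramp_nonpos[OF e 1] Q0 by (simp add: mult_nonpos_nonneg)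
      then show ?thesis using LL e mult_nonneg_nonneg[of L e] by linarith
    next
      case 2
      then have D: "0 \<le> ?D" using no_token_prob_mono[of b lam "S 1 x" c] b_pos S1 by simp
      have "?D \<le> L * \<bar>S 1 x - lam\<bar>"
        using no_token_prob_lipschitz[of b "S 1 x" lam c] b_pos S1 lam_pos lam_less by simp
      also have "\<dots> \<le> L * e" using 2 LL by (intro mult_left_mono) auto
      finally have "?D \<le> L * e" .
      moreover have "?D * (Q - ramp e ?d) \<le> ?D * 1"
        using D Q1 ramp_range(1)[of e ?d] by (intro mult_left_mono) auto
      ultimately show ?thesis by simp
    next
      case 3
      then have "0 \<le> ?D" using no_token_prob_mono[of b lam "S 1 x" c] b_pos S1 e by simp
      then have "?D * (Q - ramp e ?d) \<le> 0"
        using ramp_large[OF e 3] Q1 by (simp add: mult_nonneg_nonpos)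
      then show ?thesis using LL e mult_nonneg_nonneg[of L e] by linarith
    qed
  qed
  then show ?thesis unfolding G by (simp add: algebra_simps)
qed

lemma up_rate_nonneg: "0 \<le> up_rate k x"
  using lam_pos queue_fraction_Suc_le[of "fst x" k] by (simp add: up_rate_def)

lemma sum_up_rate: "x \<in> states \<Longrightarrow> (\<Sum>k<K. up_rate k x) \<le> lam"
proof -
  assume x: "x \<in> states"
  have "(\<Sum>k<K. up_rate k x) = lam * (no_token x * (\<Sum>k<K. S k x - S (Suc k) x) + (1 - no_token x) * (\<Sum>k<K. of_bool (k = 0)))"
    unfolding up_rate_def sum_distrib_left[symmetric] sum.distrib ..
  also have "\<dots> \<le> lam * (no_token x * 1 + (1 - no_token x) * 1)"
  proof (intro mult_left_mono add_mono)
    show "(\<Sum>k<K. S k x - S (Suc k) x) \<le> 1"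
      unfolding sum_lessThan_telescope' using S_0[OF x] queue_fraction_nonneg[of "fst x" K] by simp
    show "(\<Sum>k<K. of_bool (k = 0) :: real) \<le> 1"
      by (simp add: of_bool_def sum.delta')
  qed (use lam_pos in auto)
  finally show ?thesis by simp
qed

text \<open>
  Passing from jumps of size \<open>1 / n\<close> to derivatives costs a second-order term of size
  \<open>1 / (n\<^sup>2 * e)\<close> per jump, and level changes occur at total rate at most \<open>2 * n\<close>.
\<close>

lemma lyapunov_drift:
  assumes e: "0 < e" and x: "x \<in> states"
  shows "real n * (\<Sum>k<K.
      up_rate k x * (huber e (S (Suc k) x + 1 / real n - eql (Suc k)) - huber e (S (Suc k) x - eql (Suc k)))
      + (S (Suc k) x - S (Suc (Suc k)) x) * (huber e (S (Suc k) x - 1 / real n - eql (Suc k)) - huber e (S (Suc k) x - eql (Suc k))))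
    \<le> lam * ((no_token x - P) * flux_gap e K (fst x)) - huber e (S 1 x - lam)
      + S (Suc K) x + 1 / (e * real n)"
proof -
  let ?w = "\<lambda>k. ramp e (S (Suc k) x - eql (Suc k))"
  let ?t = "\<lambda>k. up_rate k x * (huber e (S (Suc k) x + 1 / real n - eql (Suc k)) - huber e (S (Suc k) x - eql (Suc k)))
      + (S (Suc k) x - S (Suc (Suc k)) x) * (huber e (S (Suc k) x - 1 / real n - eql (Suc k)) - huber e (S (Suc k) x - eql (Suc k)))"
  let ?s = "\<lambda>k. S (Suc k) x - S (Suc (Suc k)) x"
  define r where "r = (1 / real n)\<^sup>2 / (2 * e)"
  have termwise: "?t k \<le> (?w k * (up_rate k x - ?s k)) / real n + (up_rate k x + ?s k) * r" for k
  proof -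
    let ?d = "S (Suc k) x - eql (Suc k)"
    have "huber e (S (Suc k) x + 1 / real n - eql (Suc k)) - huber e ?d \<le> ?w k * (1 / real n) + r"
      using huber_upper[OF e, of ?d "1 / real n"] by (simp add: r_def algebra_simps)
    then have "up_rate k x * (huber e (S (Suc k) x + 1 / real n - eql (Suc k)) - huber e ?d)
        \<le> up_rate k x * (?w k * (1 / real n) + r)"
      using up_rate_nonneg by (rule mult_left_mono)
    moreover have "huber e (S (Suc k) x - 1 / real n - eql (Suc k)) - huber e ?d \<le> ?w k * (- 1 / real n) + r"
      using huber_upper[OF e, of ?d "- 1 / real n"] by (simp add: r_def algebra_simps)
    then have "?s k * (huber e (S (Suc k) x - 1 / real n - eql (Suc k)) - huber e ?d)
        \<le> ?s k * (?w k * (- 1 / real n) + r)"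
      using queue_fraction_Suc_le by (intro mult_left_mono) auto
    moreover have "up_rate k x * (?w k * (1 / real n) + r) + ?s k * (?w k * (- 1 / real n) + r)
        = (?w k * (up_rate k x - ?s k)) / real n + (up_rate k x + ?s k) * r"
      by (simp add: algebra_simps diff_divide_distrib add_divide_distrib)
    ultimately show ?thesis by linarith
  qed
  have split_sum: "real n * (\<Sum>k<K. a k / real n + u k * r) = (\<Sum>k<K. a k) + real n * r * (\<Sum>k<K. u k)"
    for a u :: "nat \<Rightarrow> real"
    using n_pos by (simp add: sum.distrib distrib_left flip: sum_divide_distrib sum_distrib_right)
  have "real n * (\<Sum>k<K. ?t k) \<le> real n * (\<Sum>k<K. (?w k * (up_rate k x - ?s k)) / real n + (up_rate k x + ?s k) * r)"
    by (intro mult_left_mono sum_mono termwise) auto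
  also have "\<dots> = (\<Sum>k<K. ?w k * (up_rate k x - ?s k)) + real n * r * (\<Sum>k<K. up_rate k x + ?s k)"
    by (rule split_sum)
  also have "real n * r * (\<Sum>k<K. up_rate k x + ?s k) \<le> real n * r * 2"
  proof (rule mult_left_mono)
    have "(\<Sum>k<K. ?s k) \<le> 1"
      unfolding sum_lessThan_telescope'[of "\<lambda>k. S (Suc k) x"]
      using queue_fraction_le_1[of "fst x" "Suc 0"] queue_fraction_nonneg[of "fst x" "Suc K"] by linarith
    then show "(\<Sum>k<K. up_rate k x + ?s k) \<le> 2"
      using sum_up_rate[OF x, of K] lam_less by (simp only: sum.distrib)
  qed (use e in \<open>simp add: r_def\<close>)
  also have "real n * r * 2 = 1 / (e * real n)"
    using n_pos e by (simp add: r_def power2_eq_square field_simps)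
  also have "(\<Sum>k<K. ?w k * (up_rate k x - ?s k))
      \<le> lam * ((no_token x - P) * flux_gap e K (fst x)) - huber e (S 1 x - eql 1) + huber e (S (Suc K) x - eql (Suc K))"
    unfolding up_rate_def flux_gap_def
    by (rule drift_inequality[OF e, where s = "\<lambda>k. S k x" and r = eql])
      (use lam_pos S_0[OF x] eql_balance in auto)
  also have "huber e (S (Suc K) x - eql (Suc K)) \<le> S (Suc K) x"
    using eql_pos[of "Suc K"] by (intro huber_le e) (auto simp: queue_fraction_nonneg)
  finally show ?thesis by (simp add: eql.simps)
qed

lemma huber_mean:
  assumes e: "0 < e" "e \<le> 1"
  shows "E (\<lambda>x. huber e (S 1 x - lam)) \<le> L * e + (2 * A + 1) / (e * real n)"
proof -
  have main: "E (\<lambda>x. huber e (S 1 x - lam)) \<le> L * e + (2 * A + 1) / (e * real n) + lam ^ Suc K" if K: "1 \<le> K" for K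
  proof -
    let ?G = "\<lambda>x. flux_gap e K (fst x)"
    let ?t = "\<lambda>k x. up_rate k x * (huber e (S (Suc k) x + 1 / real n - eql (Suc k)) - huber e (S (Suc k) x - eql (Suc k)))
      + (S (Suc k) x - S (Suc (Suc k)) x) * (huber e (S (Suc k) x - 1 / real n - eql (Suc k)) - huber e (S (Suc k) x - eql (Suc k)))"
    have tG: "tame n (2 * (1 / e)) (flux_gap e K)" by (rule flux_gap_tame[OF e])
    note bG = bounded_tame[OF tG]
    have bt: "state_bounded (?t k)" for k
      unfolding up_rate_def
      by (intro bounded_add bounded_mult bounded_diff bounded_const bounded_of_bool bounded_level
          bounded_level[of "\<lambda>x. x"] bounded_level[of "\<lambda>s. huber e (s + 1 / real n - eql (Suc k))"]
          bounded_level[of "\<lambda>s. huber e (s - 1 / real n - eql (Suc k))"]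
          bounded_level[of "\<lambda>s. huber e (s - eql (Suc k))"])
    have bh: "state_bounded (\<lambda>x. huber e (S 1 x - lam))"
      by (rule bounded_level[of "\<lambda>s. huber e (s - lam)"])
    have bz: "state_bounded (\<lambda>x. ?G x * no_token x)"
      and bp: "state_bounded (\<lambda>x. ?G x * no_token_prob b c (S 1 x))"
      by (intro bounded_mult bG bounded_of_bool bounded_level)+
    let ?R = "\<lambda>x. lam * (?G x * no_token x - P * ?G x) - huber e (S 1 x - lam) + S (Suc K) x + 1 / (e * real n)"
    have bR: "state_bounded ?R"
      by (intro bounded_add bounded_diff bounded_mult[OF bounded_const] bz bG bh bounded_const bounded_level[of "\<lambda>x. x"])
    have "0 = real n * (\<Sum>k<K. E (?t k))"
      using level_balance[where g = "\<lambda>s. huber e (s - eql (Suc _))"] by simp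
    also have "\<dots> = E (\<lambda>x. real n * (\<Sum>k<K. ?t k x))"
      using E_sum[of "{..<K}" ?t] bt by simp
    also have "\<dots> \<le> E ?R"
    proof (rule E_mono)
      fix x assume "x \<in> states"
      then show "real n * (\<Sum>k<K. ?t k x) \<le> ?R x"
        using lyapunov_drift[OF e(1), of x K]
        by (simp only: left_diff_distrib mult.commute[of "no_token x"])
    qed (intro bounded_mult[OF bounded_const] bounded_sum bt bR)+
    also have "\<dots> = lam * (E (\<lambda>x. ?G x * no_token x) - P * E ?G) - E (\<lambda>x. huber e (S 1 x - lam)) + E (S (Suc K)) + 1 / (e * real n)"
      using integrable_bounded[OF bG] integrable_bounded[OF bz] integrable_bounded[OF bh]
        integrable_bounded[OF bounded_level[of "\<lambda>x. x" "Suc K"]]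
      by simp
    finally have 1: "E (\<lambda>x. huber e (S 1 x - lam))
        \<le> lam * (E (\<lambda>x. ?G x * no_token x) - P * E ?G) + E (S (Suc K)) + 1 / (e * real n)"
      by linarith
    have "E (\<lambda>x. ?G x * no_token x) \<le> E (\<lambda>x. ?G x * no_token_prob b c (S 1 x)) + A * (2 * (1 / e)) / real n"
      using no_token_average[OF tG] by (simp only: abs_le_iff) linarith
    moreover have "E (\<lambda>x. ?G x * no_token_prob b c (S 1 x) - P * ?G x) \<le> E (\<lambda>_. L * e)"
      by (intro E_mono flux_gap_correction[OF e(1) K] bounded_diff bp bounded_mult[OF bounded_const] bG bounded_const)
    moreover have "E (\<lambda>x. ?G x * no_token_prob b c (S 1 x) - P * ?G x) = E (\<lambda>x. ?G x * no_token_prob b c (S 1 x)) - P * E ?G"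
      using integrable_bounded[OF bp] integrable_bounded[OF bG] by simp
    ultimately have "E (\<lambda>x. ?G x * no_token x) - P * E ?G \<le> L * e + 2 * A / (e * real n)"
      by (simp add: mult_ac)
    moreover have pos: "0 \<le> L * e + 2 * A / (e * real n)"
      using e averaging_const_nonneg weight_lipschitz_ge_1[of b c] b_pos by simp
    ultimately have "lam * (E (\<lambda>x. ?G x * no_token x) - P * E ?G) \<le> lam * (L * e + 2 * A / (e * real n))"
      using lam_pos by (intro mult_left_mono) auto
    also have "\<dots> \<le> L * e + 2 * A / (e * real n)"
      using lam_pos lam_less pos by (intro mult_left_le_one_le) auto
    finally show ?thesis
      using 1 mean_level_le[of K] by (simp add: add_divide_distrib)
  qed
  \<comment> \<open>The truncation level is removed with \<open>n\<close> and \<open>e\<close> fixed; none of the other terms depends on it.\<close>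
  have "(\<lambda>K. lam ^ Suc K) \<longlonglongrightarrow> 0"
    using LIMSEQ_Suc[OF LIMSEQ_power_zero[of lam]] lam_pos lam_less by simp
  then have "(\<lambda>K. L * e + (2 * A + 1) / (e * real n) + lam ^ Suc K) \<longlonglongrightarrow> L * e + (2 * A + 1) / (e * real n) + 0"
    by (intro tendsto_add tendsto_const)
  then have "E (\<lambda>x. huber e (S 1 x - lam)) \<le> L * e + (2 * A + 1) / (e * real n) + 0"
    by (rule LIMSEQ_le_const) (use main in blast)
  then show ?thesis by simp
qed

text \<open>
  A bound on the smoothed positive part suffices for the absolute deviation, because \<open>S 1\<close> has mean
  exactly \<open>lam\<close>.
\<close>

lemma busy_concentration: "E (\<lambda>x. \<bar>S 1 x - lam\<bar>) \<le> concentration_const lam mu c / sqrt (real n)"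
proof -
  \<comment> \<open>This scale balances the two error terms, of order \<open>e\<close> and \<open>1 / (e * n)\<close>.\<close>
  define e where "e = 1 / sqrt (real n)"
  have e: "0 < e" "e \<le> 1" using n_pos by (auto simp: e_def)
  have en: "e * real n = sqrt (real n)"
    by (simp add: e_def real_div_sqrt)
  have bh: "state_bounded (\<lambda>x. huber e (S 1 x - lam))"
    by (rule bounded_level[of "\<lambda>s. huber e (s - lam)"])
  have "E (\<lambda>x. \<bar>S 1 x - lam\<bar>) \<le> E (\<lambda>x. 2 * (huber e (S 1 x - lam) + e) - (S 1 x - lam))"
  proof (rule E_mono)
    fix x :: rcpb_state
    show "\<bar>S 1 x - lam\<bar> \<le> 2 * (huber e (S 1 x - lam) + e) - (S 1 x - lam)"
      using huber_ge[OF e(1), of "S 1 x - lam"] e by (simp add: abs_if)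
    show "state_bounded (\<lambda>x. \<bar>S 1 x - lam\<bar>)" by (rule bounded_level[of "\<lambda>s. \<bar>s - lam\<bar>"])
  qed (rule bounded_level[of "\<lambda>s. 2 * (huber e (s - lam) + e) - (s - lam)"])
  also have "\<dots> = 2 * (E (\<lambda>x. huber e (S 1 x - lam)) + e) - (E (S 1) - lam)"
    using integrable_bounded[OF bh] integrable_bounded[OF bounded_level[of "\<lambda>x. x" 1]] by simp
  also have "\<dots> \<le> 2 * (L * e + (2 * A + 1) / (e * real n) + e)"
    unfolding mean_level_1 diff_self diff_zero
    by (intro mult_left_mono add_right_mono huber_mean e) simp
  also have "\<dots> = concentration_const lam mu c / sqrt (real n)"
    unfolding en unfolding e_def by (simp add: concentration_const_def add_divide_distrib)
  finally show ?thesis .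
qed

lemma recursion_error_nonneg: "0 \<le> recursion_error lam mu c n"
  using averaging_const_nonneg weight_lipschitz_ge_1[of b c] b_pos
  by (simp add: recursion_error_def concentration_const_def)

section \<open>The delay bound\<close>

lemma mean_level_recursion:
  "E (S (Suc (Suc k))) \<le> lam * P * E (S (Suc k)) + recursion_error lam mu c n"
proof -
  let ?S = "S (Suc k)"
  have t: "tame n 1 (\<lambda>q. queue_fraction q (Suc k))"
    by (rule tame_level[of "\<lambda>x. x"]) auto
  have LL: "0 \<le> L" using weight_lipschitz_ge_1[of b c] b_pos by simp
  have b1: "state_bounded ?S" by (rule bounded_level[of "\<lambda>x. x"])
  have b2: "state_bounded (\<lambda>x. \<bar>S 1 x - lam\<bar>)" by (rule bounded_level[of "\<lambda>s. \<bar>s - lam\<bar>"])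
  have "E (\<lambda>x. ?S x * no_token x) \<le> E (\<lambda>x. ?S x * no_token_prob b c (S 1 x)) + A / real n"
    using no_token_average[OF t] by (simp only: abs_le_iff) simp
  also have "E (\<lambda>x. ?S x * no_token_prob b c (S 1 x)) \<le> E (\<lambda>x. P * ?S x + L * \<bar>S 1 x - lam\<bar>)"
  proof (rule E_mono)
    fix x
    have s: "0 \<le> S 1 x" "S 1 x \<le> 1" "0 \<le> ?S x" "?S x \<le> 1"
      by (simp_all only: queue_fraction_nonneg queue_fraction_le_1)
    have "no_token_prob b c (S 1 x) - P \<le> L * \<bar>S 1 x - lam\<bar>"
      using no_token_prob_lipschitz[of b "S 1 x" lam c] s b_pos lam_pos lam_less by simp
    then have "?S x * (no_token_prob b c (S 1 x) - P) \<le> ?S x * (L * \<bar>S 1 x - lam\<bar>)"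
      using s by (intro mult_left_mono)
    also have "\<dots> \<le> L * \<bar>S 1 x - lam\<bar>" using s LL by (intro mult_left_le_one_le) auto
    finally show "?S x * no_token_prob b c (S 1 x) \<le> P * ?S x + L * \<bar>S 1 x - lam\<bar>"
      by (simp add: algebra_simps)
  qed (intro bounded_add bounded_mult bounded_const b1 b2 bounded_level)+
  also have "\<dots> = P * E ?S + L * E (\<lambda>x. \<bar>S 1 x - lam\<bar>)"
    using integrable_bounded[OF b1] integrable_bounded[OF b2] by simp
  also have "\<dots> \<le> P * E ?S + L * (concentration_const lam mu c / sqrt (real n))"
    by (intro add_left_mono mult_left_mono busy_concentration LL)
  finally have "E (\<lambda>x. ?S x * no_token x) \<le> P * E ?S + recursion_error lam mu c n"
    by (simp add: recursion_error_def)
  then have "lam * E (\<lambda>x. ?S x * no_token x) \<le> lam * (P * E ?S + recursion_error lam mu c n)"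
    using lam_pos by (intro mult_left_mono) auto
  also have "\<dots> \<le> lam * P * E ?S + recursion_error lam mu c n"
    using mult_left_le_one_le[OF recursion_error_nonneg, of lam] lam_pos lam_less by (simp add: distrib_left)
  finally show ?thesis using mean_level_Suc[of k] by (simp add: mult.commute)
qed

text \<open>
  The recursion error does not decay in \<open>k\<close> and cannot be summed over all levels. Since the excess is
  also at most \<open>lam ^ k\<close>, it is at most the geometric mean of both bounds, which is summable.
\<close>

lemma queueing_delay_le:
  "queueing_delay lam p \<le> ereal ((lam + sqrt (recursion_error lam mu c n) / (1 - sqrt lam)) / (1 - lam * P) / lam - 1)"
proof -
  let ?r = "sqrt (recursion_error lam mu c n)" and ?y = "\<lambda>k. E (S (Suc k))"
  define X where "X = (\<Sum>k. ?y k)"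
  have sl: "0 \<le> sqrt lam" "sqrt lam < 1" using lam_pos lam_less by auto
  have step: "?y (Suc k) \<le> lam * P * ?y k + ?r * sqrt lam ^ k" for k
  proof (cases "?y (Suc k) \<le> lam * P * ?y k")
    case True
    have "0 \<le> ?r * sqrt lam ^ k" using recursion_error_nonneg sl by simp
    then show ?thesis using True by linarith
  next
    case False
    define D where "D = ?y (Suc k) - lam * P * ?y k"
    have D0: "0 \<le> D" using False by (simp add: D_def)
    have D1: "D \<le> recursion_error lam mu c n" using mean_level_recursion[of k] by (simp add: D_def)
    have "0 \<le> lam * P * ?y k" using lam_P mean_level_nonneg by simp
    then have "D \<le> lam ^ Suc (Suc k)" using mean_level_le[of "Suc k"] unfolding D_def by linarith
    also have "\<dots> \<le> lam ^ k" using lam_pos lam_less by (intro power_decreasing) auto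
    finally have D2: "D \<le> lam ^ k" .
    have "D\<^sup>2 \<le> recursion_error lam mu c n * lam ^ k"
      unfolding power2_eq_square by (intro mult_mono D1 D2 D0 recursion_error_nonneg)
    then have "D \<le> sqrt (recursion_error lam mu c n * lam ^ k)" by (rule real_le_rsqrt)
    also have "\<dots> = ?r * sqrt lam ^ k" by (simp add: real_sqrt_mult real_sqrt_power)
    finally show ?thesis by (simp add: D_def)
  qed
  have sy: "summable ?y" by (rule mean_level_summable)
  have sy': "summable (\<lambda>k. ?y (Suc k))" using sy summable_Suc_iff[of ?y] by blast
  have sy': "summable (\<lambda>k. ?y (Suc k))" using sy summable_Suc_iff[of ?y] by blast
  have sg0: "summable (\<lambda>k. sqrt lam ^ k)" using sl by (intro summable_geometric) simp
  have "X = ?y 0 + (\<Sum>k. ?y (Suc k))"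
    unfolding X_def using suminf_split_head[OF sy] by simp
  also have "(\<Sum>k. ?y (Suc k)) \<le> (\<Sum>k. lam * P * ?y k + ?r * sqrt lam ^ k)"
    by (intro suminf_le step sy' summable_add summable_mult sy sg0)
  also have "\<dots> = lam * P * X + ?r / (1 - sqrt lam)"
  proof -
    have "(\<Sum>k. lam * P * ?y k + ?r * sqrt lam ^ k) = (\<Sum>k. lam * P * ?y k) + (\<Sum>k. ?r * sqrt lam ^ k)"
      by (intro suminf_add[symmetric] summable_mult sy sg0)
    also have "(\<Sum>k. lam * P * ?y k) = lam * P * X"
      unfolding X_def by (rule suminf_mult[OF sy])
    also have "(\<Sum>k. ?r * sqrt lam ^ k) = ?r * (1 / (1 - sqrt lam))"
      using sl by (subst suminf_mult[OF sg0]) (simp add: suminf_geometric)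
    finally show ?thesis by simp
  qed
  finally have "X * (1 - lam * P) \<le> lam + ?r / (1 - sqrt lam)"
    using mean_level_1 by (simp add: algebra_simps)
  then have "X \<le> (lam + ?r / (1 - sqrt lam)) / (1 - lam * P)"
    using lam_P by (simp add: le_divide_eq)
  then have "X / lam - 1 \<le> (lam + ?r / (1 - sqrt lam)) / (1 - lam * P) / lam - 1"
    using lam_pos by (intro diff_right_mono divide_right_mono) auto
  then show ?thesis unfolding queueing_delay_eq X_def[symmetric] by simp
qed

end

lemma recursion_error_tendsto_0: "(\<lambda>n. recursion_error lam mu c n) \<longlonglongrightarrow> 0"
proof -
  have "(\<lambda>n. a / sqrt (real n)) \<longlonglongrightarrow> 0" for a
    by (rule tendsto_divide_0[OF tendsto_const])
      (intro filterlim_at_top_imp_at_infinity filterlim_compose[OF sqrt_at_top filterlim_real_sequentially])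
  moreover have "(\<lambda>n. a / real n) \<longlonglongrightarrow> 0" for a
    by (rule lim_const_over_n)
  ultimately show ?thesis
    unfolding recursion_error_def by (intro tendsto_add_zero tendsto_mult_right_zero)
qed

text \<open>
  For the limiting geometric profile the delay is \<open>lam / (T - lam)\<close>. Bounding \<open>alpha / lam\<close> from below
  by \<open>alpha\<close> makes the estimate uniform in \<open>lam\<close>.
\<close>

lemma limit_delay_le:
  fixes lam alpha :: real
  assumes lam: "0 < lam" "lam < 1" and c: "1 \<le> c" and alpha: "0 < alpha"
  defines "T \<equiv> token_weight (alpha / (1 - lam) / lam) c (1 - lam)"
  shows "lam / (1 - lam * (1 / T)) / lam - 1 \<le> inverse (\<Sum>k=1..c. alpha ^ k)"
proof -
  let ?G = "\<Sum>k=1..c. alpha ^ k"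
  have G: "0 < ?G" using c alpha by (intro sum_pos) auto
  have "T = (\<Sum>k\<le>c. (alpha / lam) ^ k)"
    using lam by (simp add: T_def token_weight_def)
  also have "\<dots> = 1 + (\<Sum>k=1..c. (alpha / lam) ^ k)"
    by (simp add: atMost_atLeast0 sum.atLeast_Suc_atMost)
  also have "\<dots> \<ge> 1 + ?G"
    using lam alpha by (intro add_left_mono sum_mono power_mono) (auto simp: le_divide_eq mult_left_le)
  finally have T: "1 + ?G \<le> T" .
  have "lam * ?G \<le> ?G" using lam G by simp
  then have gap: "lam * ?G \<le> T - lam" using T lam by linarith
  have "lam / (1 - lam * (1 / T)) / lam - 1 = lam / (T - lam)"
    using T G lam by (simp add: field_simps)
  also have "\<dots> \<le> lam / (lam * ?G)"
  proof (rule divide_left_mono[OF gap])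
    have "0 < lam * ?G" using lam G by simp
    moreover from this and gap have "0 < T - lam" by linarith
    ultimately show "0 < (T - lam) * (lam * ?G)" by (rule mult_pos_pos[rotated])
  qed (use lam in simp)
  also have "\<dots> = inverse ?G" using lam by (simp add: divide_inverse)
  finally show ?thesis .
qed

theorem mainTheorem3:
  fixes lam alpha :: real and c :: nat and p :: "nat \<Rightarrow> rcpb_state pmf"
  assumes "0 < lam" and "lam < 1"
    and "1 \<le> c"
    and "0 < alpha"
    and "\<And>n. c \<le> n \<Longrightarrow> rcpb_stationary n c lam (alpha / (1 - lam)) (p n)"
  shows "asymptotic_delay lam p \<le> ereal (inverse (\<Sum>k=1..c. alpha ^ k))"
proof -
  define mu where "mu = alpha / (1 - lam)"
  define P where "P = no_token_prob (mu / lam) c lam"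
  define f where "f n = (lam + sqrt (recursion_error lam mu c n) / (1 - sqrt lam)) / (1 - lam * P) / lam - 1" for n
  have mu: "0 < mu" using assms by (simp add: mu_def)
  have bound: "queueing_delay lam (p n) \<le> ereal (f n)" if "c \<le> n" for n
  proof -
    interpret rcpb_chain n c lam mu "p n"
      by unfold_locales (use assms mu that in \<open>auto simp: mu_def\<close>)
    show ?thesis using queueing_delay_le by (simp add: f_def P_def)
  qed
  have "f \<longlonglongrightarrow> (lam + sqrt 0 / (1 - sqrt lam)) / (1 - lam * P) / lam - 1"
  proof -
    have "P \<le> 1" "0 < P" unfolding P_def
      using mu assms by (auto intro: no_token_prob_le_1 no_token_prob_pos)
    then have "lam * P \<le> lam" using assms by simp
    then have "lam * P < 1" using assms by linarith
    then show ?thesis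
      unfolding f_def using assms by (intro tendsto_intros recursion_error_tendsto_0) auto
  qed
  then have "(\<lambda>n. ereal (f n)) \<longlonglongrightarrow> ereal (lam / (1 - lam * P) / lam - 1)" by simp
  then have "limsup (\<lambda>n. ereal (f n)) = ereal (lam / (1 - lam * P) / lam - 1)"
    by (intro lim_imp_Limsup) auto
  moreover have "limsup (\<lambda>n. queueing_delay lam (p n)) \<le> limsup (\<lambda>n. ereal (f n))"
    by (intro Limsup_mono eventually_sequentiallyI[of c] bound)
  ultimately have "asymptotic_delay lam p \<le> ereal (lam / (1 - lam * P) / lam - 1)"
    by (simp only: asymptotic_delay_def)
  also have "\<dots> \<le> ereal (inverse (\<Sum>k=1..c. alpha ^ k))"
    using limit_delay_le[OF assms(1-4)] by (simp only: P_def no_token_prob_def mu_def ereal_less_eq)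
  finally show ?thesis .
qed

end
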